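(* Let $\rho^*=e^{-U}$ on $\mathbb{R}$ with $U(x)=\frac{x^2}{2}+\frac{x^4}{4}+C_0$, $C_0=\ln\left(\int_{\mathbb{R}}\exp\left(-\frac{x^2}{2}-\frac{x^4}{4}\right)dx\right)$, and let $F[\rho]=\mathrm{KL}[\rho|\rho^*]$ for $\rho\in\mathcal{P}_2(\mathbb{R})$. Let $\rho_0=e^{-V_0}$ be the standard Gaussian, $V_0(x)=\frac{x^2}{2}+\ln\sqrt{2\pi}$. Let $h>0$ be arbitrary and let $\rho_1=T_\#\rho_0$ be the first forward Euler iterate with step size $h$, where $T(x)=x-h\,\nabla\frac{\delta F}{\delta\rho}\big|_{\rho_0}(x)=x-h\left(U'(x)-V_0'(x)\right)$. Then $\rho_1$ is absolutely continuous with respect to Lebesgue measure and $\rho_1\in S_F^{\mathrm{f}}$. However, the density of $\rho_1$ is discontinuous (it has no continuous representative), and hence $\rho_1\notin S_F^{W}$. Both claims hold for every $h>0$.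
   Context: $\mathcal{P}_2(\Omega)$ is the set of probability measures on $\Omega$ with finite second moment; here $\Omega=\mathbb{R}$. $T_\#\rho$ denotes the pushforward. The Kullback-Leibler divergence is $\mathrm{KL}[\rho|\rho^*]=\int \frac{d\rho}{d\rho^*}\ln\left(\frac{d\rho}{d\rho^*}\right)d\rho^*$ if $\rho\ll\rho^*$, and $+\infty$ otherwise. For $F:\mathcal{P}_2(\Omega)\to\mathbb{R}\cup\{\infty\}$, $D(F)=\{\mu\in\mathcal{P}_2(\Omega):F[\mu]<\infty\}$. First variation: a function $\frac{\delta F}{\delta\rho}\big|_\rho:\Omega\to\mathbb{R}\cup\{\infty\}$ is the first variation of $F$ at $\rho$ if for all $\nu\in D(F)$, $\int\frac{\delta F}{\delta\rho}\big|_\rho(x)\,d(\nu-\rho)(x)=\frac{d}{d\epsilon}F[(1-\epsilon)\rho+\epsilon\nu]\big|_{\epsilon=0}$ (derivative from the right). For $F=\mathrm{KL}[\cdot|e^{-U}]$ and $\rho=e^{-V}$, the first variation is $1+U-V$, with gradient $\nabla U-\nabla V$. Define $S_F^{\mathrm{f}}=\{\rho\in D(F):\nabla\frac{\delta F}{\delta\rho}\big|_\rho\text{ exists }\rho\text{-a.e.}\}$. Wasserstein differentiability: $\xi\in L^2(\rho;\mathbb{R}^d)$ is a Wasserstein gradient of $F$ at $\rho\in D(F)$ if for all $\nu\in D(F)$, $F[\nu]=F[\rho]+\int_{\Omega\times\Omega}\langle\xi(x),y-x\rangle\,d\pi(x,y)+o(W_2(\rho,\nu))$ for some $\pi\in\Pi_o(\rho,\nu)$,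 where $\Pi_o(\rho,\nu)$ is the set of optimal transport plans for the quadratic cost between $\rho$ and $\nu$. The set of such $\xi$ is $\nabla_W F[\rho]$, and $S_F^{W}=\{\rho\in D(F):\nabla_W F[\rho]\neq\emptyset\}$. *)

theory Defs
  imports "HOL-Probability.Probability"
begin

section \<open>Probability measures on the real line\<close>

definition P2 :: "real measure set" where
  "P2 = {\<mu>. prob_space \<mu> \<and> sets \<mu> = sets borel \<and> integrable \<mu> (\<lambda>x. x\<^sup>2)}"

definition eff_domain :: "(real measure \<Rightarrow> ereal) \<Rightarrow> real measure set" where
  "eff_domain F = {\<mu> \<in> P2. F \<mu> < \<infinity>}"

text \<open>The convex combination \<open>(1 - \<epsilon>) \<rho> + \<epsilon> \<nu>\<close> of two measures, for \<open>0 \<le> \<epsilon> \<le> 1\<close>.\<close>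

definition mixture :: "real \<Rightarrow> real measure \<Rightarrow> real measure \<Rightarrow> real measure" where
  "mixture \<epsilon> \<rho> \<nu> = measure_of UNIV (sets borel)
     (\<lambda>A. ennreal (1 - \<epsilon>) * emeasure \<rho> A + ennreal \<epsilon> * emeasure \<nu> A)"

section \<open>Extended-valued integrals\<close>

text \<open>\<open>e2ennreal\<close> truncates negative values to \<open>0\<close>, so the two terms are the integrals of
  the positive and of the negative part. The value is meaningful only if \<open>quasi_integrable\<close>
  holds, i.e. the difference is not \<open>\<infinity> - \<infinity>\<close>.\<close>

definition ext_integral :: "'a measure \<Rightarrow> ('a \<Rightarrow> ereal) \<Rightarrow> ereal" where
  "ext_integral M f = enn2ereal (\<integral>\<^sup>+x. e2ennreal (f x) \<partial>M) - enn2ereal (\<integral>\<^sup>+x. e2ennreal (- f x) \<partial>M)"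

definition quasi_integrable :: "'a measure \<Rightarrow> ('a \<Rightarrow> ereal) \<Rightarrow> bool" where
  "quasi_integrable M f \<longleftrightarrow> f \<in> borel_measurable M \<and>
     ((\<integral>\<^sup>+x. e2ennreal (f x) \<partial>M) < \<infinity> \<or> (\<integral>\<^sup>+x. e2ennreal (- f x) \<partial>M) < \<infinity>)"

section \<open>Kullback-Leibler divergence\<close>

text \<open>Since \<open>r ln r\<close> is bounded below (with \<open>0 ln 0 = 0\<close>), the integral against a probability
  measure \<open>\<sigma>\<close> always exists in \<open>(-\<infinity>, \<infinity>]\<close>. The library's \<open>KL_divergence\<close> is a real-valued
  Bochner integral and hence cannot take the value \<open>\<infinity>\<close>.\<close>

definition KL :: "real measure \<Rightarrow> real measure \<Rightarrow> ereal" where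
  "KL \<rho> \<sigma> = (if absolutely_continuous \<sigma> \<rho>
     then ext_integral \<sigma> (\<lambda>x. let r = enn2real (RN_deriv \<sigma> \<rho> x) in ereal (r * ln r))
     else \<infinity>)"

section \<open>First variation\<close>

text \<open>The identity \<open>\<integral> \<phi> d(\<nu> - \<rho>) = d/d\<epsilon> F[(1 - \<epsilon>) \<rho> + \<epsilon> \<nu>]\<close> at \<open>\<epsilon> = 0+\<close> is read in the
  extended reals, and \<open>\<integral> \<phi> d(\<nu> - \<rho>)\<close> as \<open>\<integral> \<phi> d\<nu> - \<integral> \<phi> d\<rho>\<close>, which has to be well-defined.
  As \<open>\<nu> = \<rho>\<close> is admissible for \<open>\<rho> \<in> eff_domain F\<close>, this forces \<open>\<integral> \<phi> d\<rho>\<close> to be finite.\<close>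

definition is_first_variation ::
    "(real measure \<Rightarrow> ereal) \<Rightarrow> real measure \<Rightarrow> (real \<Rightarrow> ereal) \<Rightarrow> bool" where
  "is_first_variation F \<rho> \<phi> \<longleftrightarrow>
     (\<forall>x. \<phi> x \<noteq> -\<infinity>) \<and>
     quasi_integrable \<rho> \<phi> \<and> \<bar>ext_integral \<rho> \<phi>\<bar> \<noteq> \<infinity> \<and>
     (\<forall>\<nu>\<in>eff_domain F. quasi_integrable \<nu> \<phi> \<and>
        ((\<lambda>\<epsilon>. (F (mixture \<epsilon> \<rho> \<nu>) - F \<rho>) / ereal \<epsilon>)
           \<longlongrightarrow> ext_integral \<nu> \<phi> - ext_integral \<rho> \<phi>) (at_right 0))"

definition has_gradient :: "(real \<Rightarrow> ereal) \<Rightarrow> real \<Rightarrow> real \<Rightarrow> bool" where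
  "has_gradient \<phi> D x \<longleftrightarrow>
     (\<forall>\<^sub>F y in nhds x. \<bar>\<phi> y\<bar> \<noteq> \<infinity>) \<and> ((\<lambda>y. real_of_ereal (\<phi> y)) has_real_derivative D) (at x)"

text \<open>A first variation is determined only up to additive constants and null sets, so the
  gradient is asked to exist for some version of it.\<close>

definition S_f :: "(real measure \<Rightarrow> ereal) \<Rightarrow> real measure set" where
  "S_f F = {\<rho> \<in> eff_domain F. \<exists>\<phi>. is_first_variation F \<rho> \<phi> \<and> (AE x in \<rho>. \<exists>D. has_gradient \<phi> D x)}"

section \<open>Wasserstein differentiability\<close>

definition couplings :: "real measure \<Rightarrow> real measure \<Rightarrow> (real \<times> real) measure set" where
  "couplings \<rho> \<nu> = {\<pi>. prob_space \<pi> \<and> sets \<pi> = sets borel \<and>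
     distr \<pi> borel fst = \<rho> \<and> distr \<pi> borel snd = \<nu>}"

definition transport_cost :: "(real \<times> real) measure \<Rightarrow> ennreal" where
  "transport_cost \<pi> = (\<integral>\<^sup>+(x, y). ennreal ((y - x)\<^sup>2) \<partial>\<pi>)"

definition optimal_plans :: "real measure \<Rightarrow> real measure \<Rightarrow> (real \<times> real) measure set" where
  "optimal_plans \<rho> \<nu> =
     {\<pi> \<in> couplings \<rho> \<nu>. \<forall>\<pi>'\<in>couplings \<rho> \<nu>. transport_cost \<pi> \<le> transport_cost \<pi>'}"

definition W2 :: "real measure \<Rightarrow> real measure \<Rightarrow> real" where
  "W2 \<rho> \<nu> = sqrt (enn2real (INF \<pi>\<in>couplings \<rho> \<nu>. transport_cost \<pi>))"

text \<open>The function \<open>p\<close> selects, for each \<open>\<nu>\<close>, the optimal plan in the expansion of \<open>F[\<nu>]\<close>.\<close>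

definition W_gradient :: "(real measure \<Rightarrow> ereal) \<Rightarrow> real measure \<Rightarrow> (real \<Rightarrow> real) set" where
  "W_gradient F \<rho> = {\<xi> \<in> borel_measurable borel. integrable \<rho> (\<lambda>x. (\<xi> x)\<^sup>2) \<and>
     (\<exists>p. (\<forall>\<nu>\<in>eff_domain F. p \<nu> \<in> optimal_plans \<rho> \<nu>) \<and>
        (\<forall>e>0. \<exists>d>0. \<forall>\<nu>\<in>eff_domain F. W2 \<rho> \<nu> < d \<longrightarrow>
           \<bar>real_of_ereal (F \<nu>) - real_of_ereal (F \<rho>) - (\<integral>(x, y). \<xi> x * (y - x) \<partial>p \<nu>)\<bar>
             \<le> e * W2 \<rho> \<nu>))}"

definition S_W :: "(real measure \<Rightarrow> ereal) \<Rightarrow> real measure set" where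
  "S_W F = {\<rho> \<in> eff_domain F. W_gradient F \<rho> \<noteq> {}}"

section \<open>The example\<close>

definition C0 :: real where
  "C0 = ln (\<integral>x. exp (- (x\<^sup>2 / 2) - x ^ 4 / 4) \<partial>lborel)"

definition U :: "real \<Rightarrow> real" where
  "U x = x\<^sup>2 / 2 + x ^ 4 / 4 + C0"

definition V0 :: "real \<Rightarrow> real" where
  "V0 x = x\<^sup>2 / 2 + ln (sqrt (2 * pi))"

definition rho_star :: "real measure" where
  "rho_star = density lborel (\<lambda>x. ennreal (exp (- U x)))"

definition rho0 :: "real measure" where
  "rho0 = density lborel (\<lambda>x. ennreal (exp (- V0 x)))"

definition F_KL :: "real measure \<Rightarrow> ereal" where
  "F_KL \<rho> = KL \<rho> rho_star"

definition T :: "real \<Rightarrow> real \<Rightarrow> real" where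
  "T h x = x - h * (deriv U x - deriv V0 x)"

definition rho1 :: "real \<Rightarrow> real measure" where
  "rho1 h = distr rho0 borel (T h)"

end

theory Submission
  imports Defs
begin

text \<open>
  \<open>T h x = x - h x\<^sup>3\<close> folds at \<open>x = a\<close> with \<open>a = 1 / sqrt (3 h)\<close>, so the density of \<open>rho1 h\<close>
  behaves like \<open>(c - y)\<close> to the power \<open>-1/2\<close> to the left of \<open>c = T h a\<close> and is bounded to its right.
  This singularity is integrable enough for the divergence to be finite, the density is positive and
  differentiable almost everywhere, and its logarithm is bounded below by a quadratic, which makes
  \<open>1 + ln (d rho1 / d rho_star)\<close> a first variation.

  A Wasserstein gradient would make \<open>F_KL\<close> Lipschitz at \<open>rho1 h\<close> in \<open>W2\<close> to first order, for any choice of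
  optimal plans. But pushing mass across \<open>c\<close> by a map that expands the interval of length \<open>\<delta>\<close> to the
  left of \<open>c\<close> and contracts the one to its right costs at most \<open>\<delta>\<close> in \<open>W2\<close>, whereas it decreases \<open>F_KL\<close>
  by a multiple of the mass on the left, which is of order \<open>sqrt \<delta>\<close>.
\<close>

section \<open>Divergence and its first variation\<close>

text \<open>Two obstacles shape the proof. The competitors \<open>\<nu>\<close> in a first variation
  have only finite divergence and finite second moment, so their densities cannot be bounded.
  Convexity of \<open>x * ln x\<close> takes the place of a bound: along a mixture it traps every
  difference quotient between the slope at 0 and the chord to 1, and both ends are integrable. On
  the Wasserstein side, a gradient comes with some selected optimal plan, which is never identified.
  The pairing with \<open>\<xi>\<close> is estimated through the transport cost alone, and an
  optimal plan costs at most as much as the coupling induced by the stretching map, so the linear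
  term is of order \<open>\<delta>\<close> whatever the selection. The order
  \<open>sqrt \<delta>\<close> originates in the double zero of \<open>crit_val h - T h x\<close> at
  \<open>x = crit h\<close>: an interval of length \<open>sqrt (crit h * \<delta>)\<close> is folded
  into one of length \<open>\<delta>\<close>. The same mass estimate excludes a continuous density,
  which would give a short interval a mass of order \<open>\<delta>\<close> only.\<close>

lemma ext_integral_ereal:
  fixes f :: "'a \<Rightarrow> real"
  assumes "integrable M f"
  shows "ext_integral M (\<lambda>x. ereal (f x)) = ereal (\<integral>x. f x \<partial>M)"
proof -
  have p: "(\<integral>\<^sup>+x. ennreal (f x) \<partial>M) < \<infinity>" and n: "(\<integral>\<^sup>+x. ennreal (- f x) \<partial>M) < \<infinity>"
    using assms by (auto simp: real_integrable_def less_top[symmetric])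
  obtain a where a: "(\<integral>\<^sup>+x. ennreal (f x) \<partial>M) = ennreal a" "a \<ge> 0"
    using p by (cases "\<integral>\<^sup>+x. ennreal (f x) \<partial>M") auto
  obtain b where b: "(\<integral>\<^sup>+x. ennreal (- f x) \<partial>M) = ennreal b" "b \<ge> 0"
    using n by (cases "\<integral>\<^sup>+x. ennreal (- f x) \<partial>M") auto
  show ?thesis
    using assms a b by (simp add: ext_integral_def real_lebesgue_integral_def enn2ereal_ennreal)
qed

lemma quasi_integrable_ereal:
  fixes f :: "'a \<Rightarrow> real"
  assumes "integrable M f"
  shows "quasi_integrable M (\<lambda>x. ereal (f x))"
  using assms by (auto simp: quasi_integrable_def real_integrable_def less_top[symmetric])

lemma integrable_between:
  fixes f g h :: "'a \<Rightarrow> real"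
  assumes "integrable M g" "integrable M h" "f \<in> borel_measurable M"
    and "AE x in M. g x \<le> f x" "AE x in M. f x \<le> h x"
  shows "integrable M f"
proof (rule Bochner_Integration.integrable_bound)
  show "integrable M (\<lambda>x. \<bar>g x\<bar> + \<bar>h x\<bar>)"
    using assms by auto
  show "AE x in M. norm (f x) \<le> norm (\<bar>g x\<bar> + \<bar>h x\<bar>)"
    using assms(4,5) by eventually_elim auto
qed fact

text \<open>Multiply \<open>ln (1/x) \<le> 1/x - 1\<close> by \<open>x\<close>. The bound keeps the
  negative part of entropies integrable, and after rescaling it is the tangent line inequality for
  \<open>x * ln x\<close> at any positive point.\<close>

lemma xlnx_ge: "x * ln x \<ge> x - 1" if "x \<ge> 0" for x :: real
proof (cases "x = 0")
  case False
  then have "ln (1/x) \<le> 1/x - 1"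
    using that by (intro ln_le_minus_one) auto
  then have "x * ln (1/x) \<le> x * (1/x - 1)"
    using that by (intro mult_left_mono) auto
  then show ?thesis
    using False that by (simp add: ln_div algebra_simps)
qed auto

lemma KL_density_eq:
  fixes \<sigma> :: "real measure" and r :: "real \<Rightarrow> real"
  assumes "sigma_finite_measure \<sigma>" and [measurable]: "r \<in> borel_measurable \<sigma>"
    and nonneg: "\<And>x. r x \<ge> 0"
    and int: "integrable \<sigma> (\<lambda>x. r x * ln (r x))"
  shows "KL (density \<sigma> (\<lambda>x. ennreal (r x))) \<sigma> = ereal (\<integral>x. r x * ln (r x) \<partial>\<sigma>)"
proof -
  interpret sigma_finite_measure \<sigma> by fact
  let ?\<nu> = "density \<sigma> (\<lambda>x. ennreal (r x))"
  have eq: "AE x in \<sigma>. enn2real (RN_deriv \<sigma> ?\<nu> x) = r x"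
    using RN_deriv_unique[of "\<lambda>x. ennreal (r x)" ?\<nu>, OF _ refl]
    by (simp, elim eventually_mono) (metis enn2real_ennreal nonneg)
  have ac: "absolutely_continuous \<sigma> ?\<nu>"
    by (rule absolutely_continuousI_density) simp
  have int': "integrable \<sigma> (\<lambda>x. enn2real (RN_deriv \<sigma> ?\<nu> x) * ln (enn2real (RN_deriv \<sigma> ?\<nu> x)))"
    by (rule integrable_cong_AE_imp[OF int]) (use eq in auto)
  have "KL ?\<nu> \<sigma> = ereal (\<integral>x. enn2real (RN_deriv \<sigma> ?\<nu> x) * ln (enn2real (RN_deriv \<sigma> ?\<nu> x)) \<partial>\<sigma>)"
    using ac ext_integral_ereal[OF int'] by (simp add: KL_def Let_def)
  also have "(\<integral>x. enn2real (RN_deriv \<sigma> ?\<nu> x) * ln (enn2real (RN_deriv \<sigma> ?\<nu> x)) \<partial>\<sigma>)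
      = (\<integral>x. r x * ln (r x) \<partial>\<sigma>)"
    by (rule integral_cong_AE) (use eq in auto)
  finally show ?thesis .
qed

text \<open>As \<open>x * ln x \<ge> - 1\<close>, the negative part has integral at most the total
  mass of \<open>\<sigma>\<close>, so a divergence below infinity forces the positive part to be
  finite as well. Finiteness of \<open>\<nu>\<close> makes \<open>RN_deriv\<close> finite almost
  everywhere, hence \<open>enn2real\<close> loses nothing.\<close>

lemma KL_finite_imp_density:
  fixes \<sigma> :: "real measure"
  assumes "finite_measure \<sigma>" "finite_measure \<nu>" "sets \<nu> = sets \<sigma>" "KL \<nu> \<sigma> < \<infinity>"
  obtains n :: "real \<Rightarrow> real" where "n \<in> borel_measurable \<sigma>" "\<And>x. n x \<ge> 0"
    "\<nu> = density \<sigma> (\<lambda>x. ennreal (n x))" "integrable \<sigma> (\<lambda>x. n x * ln (n x))"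
proof -
  interpret finite_measure \<sigma> by fact
  interpret N: finite_measure \<nu> by fact
  have ac: "absolutely_continuous \<sigma> \<nu>"
    using assms(4) by (auto simp: KL_def split: if_splits)
  define n where "n x = enn2real (RN_deriv \<sigma> \<nu> x)" for x
  have [measurable]: "n \<in> borel_measurable \<sigma>"
    unfolding n_def by measurable
  have nonneg: "n x \<ge> 0" for x
    by (simp add: n_def)
  have fin: "AE x in \<sigma>. RN_deriv \<sigma> \<nu> x \<noteq> \<infinity>"
    by (rule RN_deriv_finite) (use ac assms N.sigma_finite_measure_axioms in auto)
  have "\<nu> = density \<sigma> (RN_deriv \<sigma> \<nu>)"
    using density_RN_deriv[OF ac assms(3)] by simp
  also have "\<dots> = density \<sigma> (\<lambda>x. ennreal (n x))"
    by (rule density_cong) (use fin in \<open>auto simp: n_def less_top\<close>)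
  finally have dens: "\<nu> = density \<sigma> (\<lambda>x. ennreal (n x))" .
  have "(\<integral>\<^sup>+x. ennreal (- (n x * ln (n x))) \<partial>\<sigma>) \<le> (\<integral>\<^sup>+x. 1 \<partial>\<sigma>)"
    using xlnx_ge nonneg by (intro nn_integral_mono) (smt (verit) ennreal_1 ennreal_leI)
  also have "\<dots> < \<infinity>"
    by (simp add: less_top[symmetric])
  finally have neg: "(\<integral>\<^sup>+x. ennreal (- (n x * ln (n x))) \<partial>\<sigma>) < \<infinity>" .
  have "ext_integral \<sigma> (\<lambda>x. ereal (n x * ln (n x))) < \<infinity>"
    using assms(4) ac by (simp add: KL_def Let_def n_def)
  moreover obtain b where "(\<integral>\<^sup>+x. ennreal (- (n x * ln (n x))) \<partial>\<sigma>) = ennreal b" "b \<ge> 0"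
    using neg by (cases "\<integral>\<^sup>+x. ennreal (- (n x * ln (n x))) \<partial>\<sigma>") auto
  ultimately have "(\<integral>\<^sup>+x. ennreal (n x * ln (n x)) \<partial>\<sigma>) \<noteq> \<infinity>"
    by (auto simp: ext_integral_def)
  with neg have "integrable \<sigma> (\<lambda>x. n x * ln (n x))"
    by (auto simp: real_integrable_def)
  with nonneg dens show ?thesis
    by (intro that[of n]) auto
qed

text \<open>The value of a \<open>measure_of\<close> is known only once its set function is known to
  be a measure. Here that function agrees on Borel sets with the one of an actual density, so no
  countable additivity has to be checked.\<close>

lemma mixture_density:
  fixes \<sigma> :: "real measure"
  assumes \<sigma>: "sets \<sigma> = sets borel"
    and [measurable]: "r \<in> borel_measurable borel" "n \<in> borel_measurable borel"
    and nonneg: "\<And>x. r x \<ge> 0" "\<And>x. n x \<ge> 0" and "0 \<le> \<epsilon>" "\<epsilon> \<le> 1"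
  shows "mixture \<epsilon> (density \<sigma> (\<lambda>x. ennreal (r x))) (density \<sigma> (\<lambda>x. ennreal (n x))) =
    density \<sigma> (\<lambda>x. ennreal ((1 - \<epsilon>) * r x + \<epsilon> * n x))" (is "?L = ?R")
proof -
  have sp: "space \<sigma> = UNIV"
    using sets_eq_imp_space_eq[OF \<sigma>] by simp
  have mble [measurable]: "f \<in> borel_measurable \<sigma>" if "f \<in> borel_measurable borel" for f :: "real \<Rightarrow> ennreal"
    using that \<sigma> measurable_cong_sets by blast
  have em: "emeasure ?R A = ennreal (1 - \<epsilon>) * emeasure (density \<sigma> (\<lambda>x. ennreal (r x))) A
      + ennreal \<epsilon> * emeasure (density \<sigma> (\<lambda>x. ennreal (n x))) A" if "A \<in> sets borel" for A
  proof -
    have [measurable]: "A \<in> sets \<sigma>"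
      using that \<sigma> by simp
    have "emeasure ?R A = (\<integral>\<^sup>+x. ennreal ((1 - \<epsilon>) * r x + \<epsilon> * n x) * indicator A x \<partial>\<sigma>)"
      by (subst emeasure_density) auto
    also have "\<dots> = (\<integral>\<^sup>+x. ennreal (1 - \<epsilon>) * (ennreal (r x) * indicator A x)
        + ennreal \<epsilon> * (ennreal (n x) * indicator A x) \<partial>\<sigma>)"
      using assms by (intro nn_integral_cong)
        (auto simp: ennreal_plus ennreal_mult' indicator_def split: if_splits)
    also have "\<dots> = ennreal (1 - \<epsilon>) * (\<integral>\<^sup>+x. ennreal (r x) * indicator A x \<partial>\<sigma>)
        + ennreal \<epsilon> * (\<integral>\<^sup>+x. ennreal (n x) * indicator A x \<partial>\<sigma>)"
      by (subst nn_integral_add, simp, simp, subst nn_integral_cmult, simp, subst nn_integral_cmult) auto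
    finally show ?thesis
      by (simp add: emeasure_density)
  qed
  have "?L = measure_of UNIV (sets borel) (emeasure ?R)"
    unfolding mixture_def
    by (rule measure_of_eq) (use sets.sigma_sets_eq[of "borel :: real measure"] em in auto)
  also have "\<dots> = ?R"
    using measure_of_of_measure[of ?R] \<sigma> sp by simp
  finally show ?thesis .
qed

text \<open>Convexity: the difference quotient of \<open>m * ln m\<close> in
  \<open>\<epsilon>\<close> lies between the slope at \<open>\<epsilon> = 0\<close> and the chord to
  \<open>\<epsilon> = 1\<close>. Neither bound depends on \<open>\<epsilon>\<close>, so together
  they dominate all quotients.\<close>

lemma xlnx_convex_bounds:
  fixes r n \<epsilon> :: real
  assumes "r > 0" "n \<ge> 0" "0 < \<epsilon>" "\<epsilon> \<le> 1"
  defines "m \<equiv> (1 - \<epsilon>) * r + \<epsilon> * n"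
  shows "(1 + ln r) * (n - r) \<le> (m * ln m - r * ln r) / \<epsilon>"
    and "(m * ln m - r * ln r) / \<epsilon> \<le> n * ln n - r * ln r"
proof -
  have tangent: "x * ln x \<ge> y * ln y + (1 + ln y) * (x - y)" if "y > 0" "x \<ge> 0" for x y :: real
  proof -
    \<comment> \<open>This is \<open>xlnx_ge\<close> at \<open>x / y\<close>, scaled by
      \<open>y\<close>.\<close>
    have "y * (x / y * ln (x / y)) \<ge> y * (x / y - 1)"
      using that by (intro mult_left_mono xlnx_ge) auto
    then show ?thesis
      using that by (cases "x = 0") (auto simp: ln_div algebra_simps)
  qed
  have m0: "m \<ge> 0"
    using assms by (simp add: m_def)
  have "m * ln m \<ge> r * ln r + (1 + ln r) * (m - r)"
    using tangent[of r m] assms m0 by simp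
  moreover have "m - r = \<epsilon> * (n - r)"
    by (simp add: m_def algebra_simps)
  ultimately have "m * ln m - r * ln r \<ge> \<epsilon> * ((1 + ln r) * (n - r))"
    by (simp add: algebra_simps)
  then show "(1 + ln r) * (n - r) \<le> (m * ln m - r * ln r) / \<epsilon>"
    using assms(3) by (simp add: pos_le_divide_eq mult.commute)
  have "m * ln m \<le> (1 - \<epsilon>) * (r * ln r) + \<epsilon> * (n * ln n)"
  proof (cases "m = 0")
    case True
    \<comment> \<open>Since \<open>r > 0\<close>, the mean can vanish only if all weight sits on
      \<open>n\<close>.\<close>
    then have "\<epsilon> = 1" "n = 0"
      using assms m0 by (auto simp: m_def add_nonneg_eq_0_iff)
    then show ?thesis
      using True by simp
  next
    case False
    then have "m > 0"
      using m0 by simp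
    \<comment> \<open>Jensen's inequality: the tangents at \<open>m\<close> are averaged with
      weights \<open>1 - \<epsilon>\<close> and \<open>\<epsilon>\<close>, and the linear terms
      cancel because \<open>m\<close> is the weighted mean.\<close>
    have "(1 - \<epsilon>) * (m * ln m + (1 + ln m) * (r - m)) \<le> (1 - \<epsilon>) * (r * ln r)"
      "\<epsilon> * (m * ln m + (1 + ln m) * (n - m)) \<le> \<epsilon> * (n * ln n)"
      using assms \<open>m > 0\<close> by (intro mult_left_mono tangent; simp)+
    moreover have "(1 - \<epsilon>) * (m * ln m + (1 + ln m) * (r - m)) + \<epsilon> * (m * ln m + (1 + ln m) * (n - m)) =
        m * ln m + (1 + ln m) * ((1 - \<epsilon>) * r + \<epsilon> * n - m)"
      by (simp add: algebra_simps)
    ultimately show ?thesis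
      unfolding m_def[symmetric] by simp
  qed
  then have "m * ln m - r * ln r \<le> \<epsilon> * (n * ln n - r * ln r)"
    by (simp add: algebra_simps)
  then show "(m * ln m - r * ln r) / \<epsilon> \<le> n * ln n - r * ln r"
    using assms(3) by (simp add: pos_divide_le_eq mult.commute)
qed

text \<open>Young's inequality \<open>n ln r \<le> n ln n + r\<close> makes the positive part of \<open>ln r\<close> integrable
  against every measure of finite divergence, so only a lower bound on \<open>ln r\<close> has to be assumed.\<close>

lemma integrable_mult_ln:
  fixes r n :: "'a \<Rightarrow> real"
  assumes [measurable]: "r \<in> borel_measurable M" "n \<in> borel_measurable M"
    and pos: "\<And>x. r x > 0" "\<And>x. n x \<ge> 0"
    and "integrable M r" "integrable M (\<lambda>x. n x * ln (n x))" "integrable M (\<lambda>x. n x * b x)"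
    and lower: "\<And>x. ln (r x) \<ge> - b x"
  shows "integrable M (\<lambda>x. n x * ln (r x))"
proof (rule integrable_between)
  show "integrable M (\<lambda>x. - (n x * b x))" "integrable M (\<lambda>x. n x * ln (n x) + r x)"
    using assms by auto
  show "AE x in M. - (n x * b x) \<le> n x * ln (r x)"
    using mult_left_mono[OF lower pos(2)] by auto
  have "n x * ln (r x) \<le> n x * ln (n x) + r x" for x
  proof (cases "n x = 0")
    case False
    then have "n x > 0"
      using pos(2)[of x] by simp
    then have "n x * ln (r x / n x) \<le> n x * (r x / n x - 1)"
      using pos by (intro mult_left_mono ln_le_minus_one) auto
    then show ?thesis
      using \<open>n x > 0\<close> pos(1)[of x] by (simp add: ln_div algebra_simps)
  qed (use pos(1)[of x] in auto)
  then show "AE x in M. n x * ln (r x) \<le> n x * ln (n x) + r x"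
    by simp
qed measurable

text \<open>Dominated convergence, with the sum of the absolute values of the two convexity bounds
  as majorant.\<close>

lemma tendsto_integral_xlnx_quotient:
  fixes r n :: "'a \<Rightarrow> real"
  assumes [measurable]: "r \<in> borel_measurable M" "n \<in> borel_measurable M"
    and pos: "\<And>x. r x > 0" "\<And>x. n x \<ge> 0"
    and low: "integrable M (\<lambda>x. (1 + ln (r x)) * (n x - r x))"
    and up: "integrable M (\<lambda>x. n x * ln (n x) - r x * ln (r x))"
  shows "((\<lambda>\<epsilon>. \<integral>x. (((1 - \<epsilon>) * r x + \<epsilon> * n x) * ln ((1 - \<epsilon>) * r x + \<epsilon> * n x) - r x * ln (r x)) / \<epsilon> \<partial>M)
    \<longlongrightarrow> (\<integral>x. (1 + ln (r x)) * (n x - r x) \<partial>M)) (at_right 0)"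
proof (rule tendsto_at_right_sequentially[where b = 1])
  fix S :: "nat \<Rightarrow> real"
  assume S: "\<And>k. 0 < S k" "\<And>k. S k < 1" "S \<longlonglongrightarrow> 0"
  let ?q = "\<lambda>\<epsilon> x. (((1 - \<epsilon>) * r x + \<epsilon> * n x) * ln ((1 - \<epsilon>) * r x + \<epsilon> * n x) - r x * ln (r x)) / \<epsilon>"
  show "(\<lambda>k. \<integral>x. ?q (S k) x \<partial>M) \<longlonglongrightarrow> (\<integral>x. (1 + ln (r x)) * (n x - r x) \<partial>M)"
  proof (rule integral_dominated_convergence)
    show "integrable M (\<lambda>x. \<bar>(1 + ln (r x)) * (n x - r x)\<bar> + \<bar>n x * ln (n x) - r x * ln (r x)\<bar>)"
      using low up by auto
    have "norm (?q (S k) x) \<le> \<bar>(1 + ln (r x)) * (n x - r x)\<bar> + \<bar>n x * ln (n x) - r x * ln (r x)\<bar>" for k x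
      using xlnx_convex_bounds[of "r x" "n x" "S k", OF pos(1) pos(2) S(1) less_imp_le[OF S(2)]]
      unfolding real_norm_def by linarith
    then show "AE x in M. norm (?q (S k) x) \<le> \<bar>(1 + ln (r x)) * (n x - r x)\<bar> + \<bar>n x * ln (n x) - r x * ln (r x)\<bar>" for k
      by simp
    have "(\<lambda>k. ?q (S k) x) \<longlonglongrightarrow> (1 + ln (r x)) * (n x - r x)" for x
    proof -
      let ?f = "\<lambda>\<epsilon>. ((1 - \<epsilon>) * r x + \<epsilon> * n x) * ln ((1 - \<epsilon>) * r x + \<epsilon> * n x)"
      \<comment> \<open>At \<open>\<epsilon> = 0\<close> the argument of the logarithm is
        \<open>r x > 0\<close>, so the derivative exists even where \<open>n x = 0\<close>.\<close>
      have "(?f has_real_derivative (1 + ln (r x)) * (n x - r x)) (at 0)"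
        using pos(1)[of x] by (auto intro!: derivative_eq_intros simp: field_simps)
      then have "((\<lambda>\<epsilon>. (?f \<epsilon> - ?f 0) / (\<epsilon> - 0)) \<longlongrightarrow> (1 + ln (r x)) * (n x - r x)) (at 0)"
        by (simp only: has_field_derivative_iff)
      moreover have "filterlim S (at 0) sequentially"
        using S by (auto simp: filterlim_at eventually_sequentially less_imp_neq intro!: exI[of _ 0])
           (metis less_irrefl)
      ultimately have "((\<lambda>k. (?f (S k) - ?f 0) / (S k - 0)) \<longlongrightarrow> (1 + ln (r x)) * (n x - r x)) sequentially"
        by (rule filterlim_compose)
      then show ?thesis
        by simp
    qed
    then show "AE x in M. (\<lambda>k. ?q (S k) x) \<longlonglongrightarrow> (1 + ln (r x)) * (n x - r x)"
      by simp
  qed measurable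
qed simp

text \<open>A lower bound of quadratic growth on \<open>ln r\<close> is what a finite second moment
  can pay for: it is integrable against every admissible \<open>\<nu>\<close>, and Young's
  inequality controls the other side.\<close>

lemma first_variation_KL:
  fixes \<sigma> :: "real measure" and r :: "real \<Rightarrow> real"
  assumes fin: "finite_measure \<sigma>" and sets: "sets \<sigma> = sets borel"
    and [measurable]: "r \<in> borel_measurable borel"
    and pos: "\<And>x. r x > 0"
    and prob: "prob_space (density \<sigma> (\<lambda>x. ennreal (r x)))"
    and rlnr: "integrable \<sigma> (\<lambda>x. r x * ln (r x))"
    and lower: "\<And>x. ln (r x) \<ge> - (C * (1 + x\<^sup>2))"
  shows "is_first_variation (\<lambda>\<mu>. KL \<mu> \<sigma>) (density \<sigma> (\<lambda>x. ennreal (r x))) (\<lambda>x. ereal (1 + ln (r x)))"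
proof -
  interpret finite_measure \<sigma> by fact
  let ?\<rho> = "density \<sigma> (\<lambda>x. ennreal (r x))"
  have mble [measurable_cong]: "measurable \<sigma> N = measurable borel N" for N :: "real measure"
    by (rule measurable_cong_sets) (use sets in auto)
  have int_dens: "integrable \<sigma> f" if "prob_space (density \<sigma> (\<lambda>x. ennreal (f x)))"
      "f \<in> borel_measurable borel" "\<And>x. f x \<ge> 0" for f
  proof -
    interpret D: prob_space "density \<sigma> (\<lambda>x. ennreal (f x))" by fact
    have "integrable (density \<sigma> (\<lambda>x. ennreal (f x))) (\<lambda>x. 1::real)"
      by simp
    then show ?thesis
      using that by (subst (asm) integrable_density) auto
  qed
  have r: "integrable \<sigma> r"
    using prob pos by (intro int_dens) (auto intro: less_imp_le)
  have KL_r: "KL ?\<rho> \<sigma> = ereal (\<integral>x. r x * ln (r x) \<partial>\<sigma>)"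
    by (rule KL_density_eq) (use rlnr pos sigma_finite_measure_axioms in \<open>auto intro: less_imp_le\<close>)
  have int_\<rho>: "integrable ?\<rho> (\<lambda>x. 1 + ln (r x))"
    using r rlnr pos by (subst integrable_density) (auto simp: algebra_simps intro: less_imp_le)
  have val_\<rho>: "(\<integral>x. 1 + ln (r x) \<partial>?\<rho>) = (\<integral>x. r x * (1 + ln (r x)) \<partial>\<sigma>)"
    using pos by (subst integral_density) (auto intro: less_imp_le)
  have main: "quasi_integrable \<nu> (\<lambda>x. ereal (1 + ln (r x))) \<and>
      ((\<lambda>\<epsilon>. (KL (mixture \<epsilon> ?\<rho> \<nu>) \<sigma> - KL ?\<rho> \<sigma>) / ereal \<epsilon>) \<longlongrightarrow>
        ext_integral \<nu> (\<lambda>x. ereal (1 + ln (r x))) - ext_integral ?\<rho> (\<lambda>x. ereal (1 + ln (r x)))) (at_right 0)"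
    if "\<nu> \<in> eff_domain (\<lambda>\<mu>. KL \<mu> \<sigma>)" for \<nu>
  proof -
    have \<nu>: "prob_space \<nu>" "sets \<nu> = sets borel" "integrable \<nu> (\<lambda>x. x\<^sup>2)" "KL \<nu> \<sigma> < \<infinity>"
      using that by (auto simp: eff_domain_def P2_def)
    interpret N: prob_space \<nu> by fact
    obtain n where n: "n \<in> borel_measurable \<sigma>" "\<And>x. n x \<ge> 0"
      "\<nu> = density \<sigma> (\<lambda>x. ennreal (n x))" "integrable \<sigma> (\<lambda>x. n x * ln (n x))"
      using KL_finite_imp_density[OF fin N.finite_measure_axioms _ \<nu>(4)] \<nu>(2) sets by metis
    have [measurable]: "n \<in> borel_measurable borel"
      using n(1) mble by simp
    have n_int: "integrable \<sigma> n"
      using n \<nu>(1) by (intro int_dens) auto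
    have "integrable \<nu> (\<lambda>x. C * (1 + x\<^sup>2))"
      using \<nu>(3) by auto
    then have nC: "integrable \<sigma> (\<lambda>x. n x * (C * (1 + x\<^sup>2)))"
      unfolding n(3) using n(1,2) by (subst (asm) integrable_density) auto
    have nlnr: "integrable \<sigma> (\<lambda>x. n x * ln (r x))"
      by (rule integrable_mult_ln[OF _ n(1) pos n(2) r n(4) nC lower]) measurable
    have int_\<nu>: "integrable \<nu> (\<lambda>x. 1 + ln (r x))"
      unfolding n(3) using n(1,2) n_int nlnr by (subst integrable_density) (auto simp: algebra_simps)
    have val_\<nu>: "(\<integral>x. 1 + ln (r x) \<partial>\<nu>) = (\<integral>x. n x * (1 + ln (r x)) \<partial>\<sigma>)"
      unfolding n(3) using n(1,2) by (subst integral_density) auto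
    have low: "integrable \<sigma> (\<lambda>x. (1 + ln (r x)) * (n x - r x))"
      using n_int nlnr r rlnr by (simp add: algebra_simps)
    have diff: "(\<integral>x. 1 + ln (r x) \<partial>\<nu>) - (\<integral>x. 1 + ln (r x) \<partial>?\<rho>) = (\<integral>x. (1 + ln (r x)) * (n x - r x) \<partial>\<sigma>)"
    proof -
      have "integrable \<sigma> (\<lambda>x. n x * (1 + ln (r x)))" "integrable \<sigma> (\<lambda>x. r x * (1 + ln (r x)))"
        using n_int nlnr r rlnr by (simp_all add: algebra_simps)
      from Bochner_Integration.integral_diff[OF this] show ?thesis
        unfolding val_\<nu> val_\<rho> by (simp add: algebra_simps)
    qed
    let ?m = "\<lambda>\<epsilon> x. (1 - \<epsilon>) * r x + \<epsilon> * n x"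
    have quot: "(KL (mixture \<epsilon> ?\<rho> \<nu>) \<sigma> - KL ?\<rho> \<sigma>) / ereal \<epsilon> =
        ereal (\<integral>x. (?m \<epsilon> x * ln (?m \<epsilon> x) - r x * ln (r x)) / \<epsilon> \<partial>\<sigma>)" if "0 < \<epsilon>" "\<epsilon> < 1" for \<epsilon>
    proof -
      \<comment> \<open>The quotient is integrable because it is sandwiched; undoing the division
        and the subtraction yields finite entropy of the mixture.\<close>
      have "integrable \<sigma> (\<lambda>x. (?m \<epsilon> x * ln (?m \<epsilon> x) - r x * ln (r x)) / \<epsilon>)"
        by (rule integrable_between[OF low, of "\<lambda>x. n x * ln (n x) - r x * ln (r x)"])
           (use xlnx_convex_bounds[OF pos n(2), of \<epsilon>] that rlnr n in auto)
      then have "integrable \<sigma> (\<lambda>x. \<epsilon> * ((?m \<epsilon> x * ln (?m \<epsilon> x) - r x * ln (r x)) / \<epsilon>))"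
        by (rule integrable_mult_right)
      then have "integrable \<sigma> (\<lambda>x. ?m \<epsilon> x * ln (?m \<epsilon> x) - r x * ln (r x))"
        using that by simp
      from Bochner_Integration.integrable_add[OF this rlnr]
      have mlnm: "integrable \<sigma> (\<lambda>x. ?m \<epsilon> x * ln (?m \<epsilon> x))"
        by simp
      have "mixture \<epsilon> ?\<rho> \<nu> = density \<sigma> (\<lambda>x. ennreal (?m \<epsilon> x))"
        unfolding n(3) by (rule mixture_density) (use sets n pos that in \<open>auto intro: less_imp_le\<close>)
      moreover have "KL (density \<sigma> (\<lambda>x. ennreal (?m \<epsilon> x))) \<sigma> = ereal (\<integral>x. ?m \<epsilon> x * ln (?m \<epsilon> x) \<partial>\<sigma>)"
        by (rule KL_density_eq)
           (use that n(2) less_imp_le[OF pos] mlnm sigma_finite_measure_axioms in auto)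
      ultimately have "KL (mixture \<epsilon> ?\<rho> \<nu>) \<sigma> = ereal (\<integral>x. ?m \<epsilon> x * ln (?m \<epsilon> x) \<partial>\<sigma>)"
        by simp
      then show ?thesis
        using that mlnm rlnr by (simp add: KL_r)
    qed
    have "((\<lambda>\<epsilon>. \<integral>x. (?m \<epsilon> x * ln (?m \<epsilon> x) - r x * ln (r x)) / \<epsilon> \<partial>\<sigma>) \<longlongrightarrow>
        (\<integral>x. (1 + ln (r x)) * (n x - r x) \<partial>\<sigma>)) (at_right 0)"
      by (rule tendsto_integral_xlnx_quotient) (use n pos low rlnr in auto)
    then have "((\<lambda>\<epsilon>. ereal (\<integral>x. (?m \<epsilon> x * ln (?m \<epsilon> x) - r x * ln (r x)) / \<epsilon> \<partial>\<sigma>)) \<longlongrightarrow>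
        ereal (\<integral>x. (1 + ln (r x)) * (n x - r x) \<partial>\<sigma>)) (at_right 0)"
      by simp
    moreover have "\<forall>\<^sub>F \<epsilon> in at_right 0. ereal (\<integral>x. (?m \<epsilon> x * ln (?m \<epsilon> x) - r x * ln (r x)) / \<epsilon> \<partial>\<sigma>) =
        (KL (mixture \<epsilon> ?\<rho> \<nu>) \<sigma> - KL ?\<rho> \<sigma>) / ereal \<epsilon>"
      using quot by (auto simp: eventually_at_right_field intro!: exI[of _ 1])
    ultimately have "((\<lambda>\<epsilon>. (KL (mixture \<epsilon> ?\<rho> \<nu>) \<sigma> - KL ?\<rho> \<sigma>) / ereal \<epsilon>) \<longlongrightarrow>
        ereal (\<integral>x. (1 + ln (r x)) * (n x - r x) \<partial>\<sigma>)) (at_right 0)"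
      by (rule Lim_transform_eventually)
    then show ?thesis
      using quasi_integrable_ereal[OF int_\<nu>] ext_integral_ereal[OF int_\<nu>] ext_integral_ereal[OF int_\<rho>] diff
      by simp
  qed
  show ?thesis
    unfolding is_first_variation_def
    using quasi_integrable_ereal[OF int_\<rho>] ext_integral_ereal[OF int_\<rho>] main by auto
qed

section \<open>Densities of pushforwards\<close>

text \<open>The classical theorem concerns absolute integrability for the completed measure. Both
  integrands are Borel, so they can be moved there and back. The candidate density \<open>k\<close>
  is prescribed by \<open>k (t x) * \<bar>t' x\<bar> = w x\<close> instead of by a formula.\<close>

lemma nn_integral_change_of_variables:
  fixes w t t' k :: "real \<Rightarrow> real"
  assumes [measurable]: "J \<in> sets borel" "E \<in> sets borel" "w \<in> borel_measurable borel"
      "t \<in> borel_measurable borel" "k \<in> borel_measurable borel"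
    and w: "\<And>x. w x \<ge> 0" "integrable lborel w"
    and deriv: "\<And>x. x \<in> J \<Longrightarrow> (t has_real_derivative t' x) (at x)" and inj: "inj_on t J"
    and k: "\<And>y. k y \<ge> 0" "\<And>x. x \<in> J \<Longrightarrow> k (t x) * \<bar>t' x\<bar> = w x" "\<And>y. y \<notin> t ` J \<Longrightarrow> k y = 0"
  shows "(\<integral>\<^sup>+x. ennreal (w x * indicator E (t x) * indicator J x) \<partial>lborel)
      = (\<integral>\<^sup>+y. ennreal (k y * indicator E y) \<partial>lborel)"
proof -
  define f where "f y = k y * indicator E y" for y
  define g where "g x = w x * indicator E (t x) * indicator J x" for x
  have [measurable]: "f \<in> borel_measurable borel" "g \<in> borel_measurable borel"
    unfolding f_def g_def by measurable
  have "integrable lborel g"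
    unfolding g_def by (rule Bochner_Integration.integrable_bound[OF w(2)]) (use w(1) in \<open>auto simp: indicator_def\<close>)
  then have gL: "integrable lebesgue g"
    by (simp add: integrable_completion)
  have g_eq: "indicator J x *\<^sub>R (\<bar>t' x\<bar> * f (t x)) = g x" for x
    using k(2)[of x] by (auto simp: indicator_def f_def g_def mult_ac)
  have f_eq: "indicator (t ` J) y *\<^sub>R f y = f y" for y
    using k(3)[of y] by (auto simp: indicator_def f_def)
  have abs: "(\<lambda>x. \<bar>t' x\<bar> * f (t x)) absolutely_integrable_on J"
    unfolding set_integrable_def g_eq by (rule gL)
  then have "f absolutely_integrable_on (t ` J) \<and>
      integral (t ` J) f = integral J (\<lambda>x. \<bar>t' x\<bar> * f (t x))"
    using deriv inj
    by (subst has_absolute_integral_change_of_variables_1'[where S = J and g = t and g' = t', symmetric])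
       (auto intro: has_field_derivative_at_within)
  then have fL: "f absolutely_integrable_on (t ` J)"
    and eq: "integral (t ` J) f = integral J (\<lambda>x. \<bar>t' x\<bar> * f (t x))"
    by auto
  have fB: "integrable lborel f"
    using fL by (simp add: set_integrable_def f_eq integrable_completion del: real_scaleR_def)
  have "(\<integral>x. g x \<partial>lborel) = (\<integral>x. f x \<partial>lborel)"
    using eq set_lebesgue_integral_eq_integral(2)[OF fL] set_lebesgue_integral_eq_integral(2)[OF abs]
    by (simp add: set_lebesgue_integral_def g_eq f_eq integral_completion del: real_scaleR_def)
  moreover have "(\<integral>\<^sup>+x. ennreal (g x) \<partial>lborel) = ennreal (\<integral>x. g x \<partial>lborel)"
    by (rule nn_integral_eq_integral[OF \<open>integrable lborel g\<close>]) (use w(1) in \<open>auto simp: g_def\<close>)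
  moreover have "(\<integral>\<^sup>+x. ennreal (f x) \<partial>lborel) = ennreal (\<integral>x. f x \<partial>lborel)"
    by (rule nn_integral_eq_integral[OF fB]) (use k(1) in \<open>auto simp: f_def\<close>)
  ultimately show ?thesis
    by (simp add: f_def g_def)
qed

text \<open>For a piecewise injective map each branch contributes its own change of variables, and
  almost every point lies on exactly one branch. Used with three branches for the Euler map and with
  one for the stretching map.\<close>

lemma distr_density_branches:
  fixes w t t' :: "real \<Rightarrow> real" and J :: "'i \<Rightarrow> real set" and k :: "'i \<Rightarrow> real \<Rightarrow> real"
  assumes I: "finite I" "disjoint_family_on J I" "AE x in lborel. x \<in> (\<Union>i\<in>I. J i)"
    and J: "\<And>i. i \<in> I \<Longrightarrow> J i \<in> sets borel"
    and [measurable]: "w \<in> borel_measurable borel" "t \<in> borel_measurable borel"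
    and kb: "\<And>i. i \<in> I \<Longrightarrow> k i \<in> borel_measurable borel"
    and w: "\<And>x. w x \<ge> 0" "integrable lborel w"
    and deriv: "\<And>i x. i \<in> I \<Longrightarrow> x \<in> J i \<Longrightarrow> (t has_real_derivative t' x) (at x)"
    and inj: "\<And>i. i \<in> I \<Longrightarrow> inj_on t (J i)"
    and k: "\<And>i y. i \<in> I \<Longrightarrow> k i y \<ge> 0"
      "\<And>i x. i \<in> I \<Longrightarrow> x \<in> J i \<Longrightarrow> k i (t x) * \<bar>t' x\<bar> = w x"
      "\<And>i y. i \<in> I \<Longrightarrow> y \<notin> t ` J i \<Longrightarrow> k i y = 0"
  shows "distr (density lborel (\<lambda>x. ennreal (w x))) borel t = density lborel (\<lambda>y. ennreal (\<Sum>i\<in>I. k i y))"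
proof (rule measure_eqI)
  fix E assume "E \<in> sets (distr (density lborel (\<lambda>x. ennreal (w x))) borel t)"
  then have [measurable]: "E \<in> sets borel"
    by simp
  have "emeasure (distr (density lborel (\<lambda>x. ennreal (w x))) borel t) E
      = (\<integral>\<^sup>+x. ennreal (w x) * indicator (t -` E) x \<partial>lborel)"
    using measurable_sets_borel[of t borel E] by (subst emeasure_distr) (auto simp: emeasure_density)
  also have "\<dots> = (\<integral>\<^sup>+x. (\<Sum>i\<in>I. ennreal (w x * indicator E (t x) * indicator (J i) x)) \<partial>lborel)"
  proof (rule nn_integral_cong_AE)
    have "ennreal (w x) * indicator (t -` E) x = (\<Sum>i\<in>I. ennreal (w x * indicator E (t x) * indicator (J i) x))"
      if x: "x \<in> (\<Union>i\<in>I. J i)" for x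
    proof -
      have "(\<Sum>i\<in>I. indicator (J i) x :: real) = 1"
        using indicator_UN_disjoint[OF I(1,2), of x] x by (simp add: indicator_def)
      then have "(\<Sum>i\<in>I. w x * indicator E (t x) * indicator (J i) x) = w x * indicator E (t x)"
        by (simp add: sum_distrib_left[symmetric])
      then show ?thesis
        using w(1)[of x] by (subst sum_ennreal) (auto simp: indicator_def split: if_splits)
    qed
    with I(3) show "AE x in lborel. ennreal (w x) * indicator (t -` E) x
        = (\<Sum>i\<in>I. ennreal (w x * indicator E (t x) * indicator (J i) x))"
      by (auto elim: eventually_mono)
  qed
  also have "\<dots> = (\<Sum>i\<in>I. \<integral>\<^sup>+x. ennreal (w x * indicator E (t x) * indicator (J i) x) \<partial>lborel)"
  proof (rule nn_integral_sum)
    fix i assume "i \<in> I"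
    from J[OF this] show "(\<lambda>x. ennreal (w x * indicator E (t x) * indicator (J i) x)) \<in> borel_measurable lborel"
      by measurable
  qed
  also have "\<dots> = (\<Sum>i\<in>I. \<integral>\<^sup>+y. ennreal (k i y * indicator E y) \<partial>lborel)"
    using J kb w deriv inj k
    by (intro sum.cong refl nn_integral_change_of_variables[where t' = t']) auto
  also have "\<dots> = (\<integral>\<^sup>+y. (\<Sum>i\<in>I. ennreal (k i y * indicator E y)) \<partial>lborel)"
    by (rule nn_integral_sum[symmetric]) (use kb in auto)
  also have "\<dots> = (\<integral>\<^sup>+y. ennreal (\<Sum>i\<in>I. k i y) * indicator E y \<partial>lborel)"
    using k(1) by (intro nn_integral_cong) (auto simp: indicator_def sum_nonneg)
  also have "\<dots> = emeasure (density lborel (\<lambda>y. ennreal (\<Sum>i\<in>I. k i y))) E"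
    using kb by (subst emeasure_density) auto
  finally show "emeasure (distr (density lborel (\<lambda>x. ennreal (w x))) borel t) E
      = emeasure (density lborel (\<lambda>y. ennreal (\<Sum>i\<in>I. k i y))) E" .
qed simp

text \<open>One branch's term of the transfer (Perron-Frobenius) operator of
  \<open>t\<close>.\<close>

definition branch_density :: "(real \<Rightarrow> real) \<Rightarrow> (real \<Rightarrow> real) \<Rightarrow> (real \<Rightarrow> real) \<Rightarrow> real set \<Rightarrow> real \<Rightarrow> real" where
  "branch_density w t t' J y =
     (if y \<in> t ` J then w (the_inv_into J t y) / \<bar>t' (the_inv_into J t y)\<bar> else 0)"

lemma branch_density_image:
  "inj_on t J \<Longrightarrow> x \<in> J \<Longrightarrow> branch_density w t t' J (t x) = w x / \<bar>t' x\<bar>"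
  by (simp add: branch_density_def the_inv_into_f_f)

lemma branch_density_outside: "y \<notin> t ` J \<Longrightarrow> branch_density w t t' J y = 0"
  by (simp add: branch_density_def)

lemma branch_density_nonneg: "(\<And>x. w x \<ge> 0) \<Longrightarrow> branch_density w t t' J y \<ge> 0"
  by (simp add: branch_density_def)

lemma has_real_derivative_the_inv_into:
  fixes t t' :: "real \<Rightarrow> real"
  assumes J: "open J" "inj_on t J" "x \<in> J"
    and deriv: "\<And>x. x \<in> J \<Longrightarrow> (t has_real_derivative t' x) (at x)" "\<And>x. x \<in> J \<Longrightarrow> t' x \<noteq> 0"
  shows "(the_inv_into J t has_real_derivative inverse (t' x)) (at (t x))"
  unfolding has_field_derivative_def
proof (rule has_derivative_inverse_strong[where S = J and f' = "(*) (t' x)" and f = t and x = x])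
  show "continuous_on J t"
    using deriv(1) by (meson DERIV_isCont continuous_at_imp_continuous_on)
  show "(t has_derivative (*) (t' x)) (at x)"
    using deriv(1)[OF J(3)] by (simp add: has_field_derivative_def)
qed (use J deriv(2) in \<open>auto simp: the_inv_into_f_f fun_eq_iff\<close>)

lemma open_branch_image:
  fixes t :: "real \<Rightarrow> real"
  assumes "open J" "inj_on t J" "\<And>x. x \<in> J \<Longrightarrow> (t has_real_derivative t' x) (at x)"
  shows "open (t ` J)"
  using assms by (intro invariance_of_domain)
    (auto intro!: continuous_at_imp_continuous_on intro: DERIV_isCont)

lemma differentiable_branch_density:
  fixes t t' :: "real \<Rightarrow> real"
  assumes J: "open J" "inj_on t J"
    and deriv: "\<And>x. x \<in> J \<Longrightarrow> (t has_real_derivative t' x) (at x)" "\<And>x. x \<in> J \<Longrightarrow> t' x \<noteq> 0"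
    and diff: "\<And>x. x \<in> J \<Longrightarrow> w differentiable at x" "\<And>x. x \<in> J \<Longrightarrow> t' differentiable at x"
    and y: "y \<in> t ` J"
  shows "branch_density w t t' J differentiable at y"
proof -
  let ?s = "the_inv_into J t"
  obtain x where x: "x \<in> J" "y = t x"
    using y by blast
  have "((\<lambda>z. w z / \<bar>t' z\<bar>) \<circ> ?s) differentiable at y"
  proof (rule differentiable_chain_at)
    show "?s differentiable at y"
      using has_real_derivative_the_inv_into[OF J x(1) deriv] x(2)
      by (auto simp: real_differentiable_def)
    have "abs differentiable at (t' x)"
      using differentiable_norm_at[of "t' x"] deriv(2)[OF x(1)] by (simp add: real_norm_def[abs_def])
    then have "(abs \<circ> t') differentiable at x"
      using diff(2)[OF x(1)] by (intro differentiable_chain_at)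
    then have "(\<lambda>z. w z / \<bar>t' z\<bar>) differentiable at x"
      using diff(1)[OF x(1)] deriv(2)[OF x(1)] by (intro differentiable_divide) (auto simp: o_def)
    then show "(\<lambda>z. w z / \<bar>t' z\<bar>) differentiable at (?s y)"
      using x J by (simp add: the_inv_into_f_f)
  qed
  then obtain D where "((\<lambda>z. w z / \<bar>t' z\<bar>) \<circ> ?s has_real_derivative D) (at y)"
    by (auto simp: real_differentiable_def)
  then have "(branch_density w t t' J has_real_derivative D) (at y)"
    by (rule has_field_derivative_transform_within_open[OF _ open_branch_image[OF J deriv(1)] y])
       (auto simp: branch_density_def)
  then show ?thesis
    by (auto simp: real_differentiable_def)
qed

text \<open>Inside the open image the inverse function theorem applies, and on the exterior the
  function is locally zero. Only the frontier is left; it is null because the image of a connected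
  set is an interval.\<close>

lemma AE_differentiable_branch_density:
  fixes t t' :: "real \<Rightarrow> real"
  assumes J: "open J" "connected J" "inj_on t J"
    and deriv: "\<And>x. x \<in> J \<Longrightarrow> (t has_real_derivative t' x) (at x)" "\<And>x. x \<in> J \<Longrightarrow> t' x \<noteq> 0"
    and diff: "\<And>x. x \<in> J \<Longrightarrow> w differentiable at x" "\<And>x. x \<in> J \<Longrightarrow> t' differentiable at x"
  shows "AE y in lborel. branch_density w t t' J differentiable at y"
proof -
  have cont: "continuous_on J t"
    using deriv(1) by (meson DERIV_isCont continuous_at_imp_continuous_on)
  have "convex (t ` J)"
    using connected_continuous_image[OF cont J(2)] by (simp add: connected_convex_1)
  then have "frontier (t ` J) \<in> null_sets lborel"
    using negligible_convex_frontier[of "t ` J"]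
    by (simp add: negligible_iff_null_sets null_sets_completion_iff)
  then have "AE y in lborel. y \<notin> frontier (t ` J)"
    by (rule AE_not_in)
  then show ?thesis
  proof eventually_elim
    case (elim y)
    show ?case
    proof (cases "y \<in> t ` J")
      case True
      then show ?thesis
        using assms by (intro differentiable_branch_density) auto
    next
      case False
      then have "y \<in> - closure (t ` J)"
        using elim open_branch_image[OF J(1,3) deriv(1)] by (auto simp: frontier_def interior_open)
      have "((\<lambda>_. 0) has_real_derivative 0) (at y)"
        by simp
      then have "(branch_density w t t' J has_real_derivative 0) (at y)"
        by (rule has_field_derivative_transform_within_open[where S = "- closure (t ` J)"])
           (use \<open>y \<in> - closure (t ` J)\<close> closure_subset[of "t ` J"] in \<open>auto simp: branch_density_def\<close>)
      then show ?thesis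
        by (auto simp: real_differentiable_def)
    qed
  qed
qed

lemma borel_measurable_branch_density:
  fixes t t' :: "real \<Rightarrow> real"
  assumes J: "open J" "inj_on t J"
    and deriv: "\<And>x. x \<in> J \<Longrightarrow> (t has_real_derivative t' x) (at x)" "\<And>x. x \<in> J \<Longrightarrow> t' x \<noteq> 0"
    and [measurable]: "w \<in> borel_measurable borel" "t' \<in> borel_measurable borel"
  shows "branch_density w t t' J \<in> borel_measurable borel"
proof -
  \<comment> \<open>Off the image \<open>the_inv_into\<close> is unspecified; the default 0 gives a
    total Borel function.\<close>
  let ?s = "\<lambda>y. if y \<in> t ` J then the_inv_into J t y else 0"
  have "continuous_on (t ` J) (the_inv_into J t)"
    using has_real_derivative_the_inv_into[OF J _ deriv]
    by (auto intro!: continuous_at_imp_continuous_on intro: DERIV_isCont)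
  then have [measurable]: "?s \<in> borel_measurable borel"
    using open_branch_image[OF J deriv(1)] by (intro borel_measurable_continuous_on_if) auto
  have [measurable]: "t ` J \<in> sets borel"
    using open_branch_image[OF J deriv(1)] by auto
  have "branch_density w t t' J = (\<lambda>y. if y \<in> t ` J then w (?s y) / \<bar>t' (?s y)\<bar> else 0)"
    by (auto simp: branch_density_def)
  also have "\<dots> \<in> borel_measurable borel"
    by measurable
  finally show ?thesis .
qed

section \<open>The Gaussian and the reference measure\<close>

lemma deriv_U: "(U has_real_derivative x + x ^ 3) (at x)"
  unfolding U_def[abs_def] by (auto intro!: derivative_eq_intros simp: power3_eq_cube field_simps)

lemma deriv_V0: "(V0 has_real_derivative x) (at x)"
  unfolding V0_def[abs_def] by (auto intro!: derivative_eq_intros)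

lemma deriv_U_minus_deriv_V0: "deriv U x - deriv V0 x = x ^ 3"
  using deriv_U[THEN DERIV_imp_deriv, of x] deriv_V0[THEN DERIV_imp_deriv, of x] by simp

lemma T_eq: "T h x = x - h * x ^ 3"
  by (simp add: T_def deriv_U_minus_deriv_V0)

lemma borel_measurable_T [measurable]: "T h \<in> borel_measurable borel"
  by (simp add: T_eq[abs_def])

lemma borel_measurable_U [measurable]: "U \<in> borel_measurable borel"
  by (simp add: U_def[abs_def])

lemma exp_minus_V0: "exp (- V0 x) = std_normal_density x"
proof -
  have "exp (- V0 x) = exp (- (x\<^sup>2 / 2)) / exp (ln (sqrt (2 * pi)))"
    unfolding exp_diff[symmetric] by (simp add: V0_def)
  then show ?thesis
    by (simp add: normal_density_def)
qed

lemma rho0_eq: "rho0 = density lborel (\<lambda>x. ennreal (std_normal_density x))"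
  by (simp add: rho0_def exp_minus_V0)

lemma std_normal_density_le_1: "std_normal_density x \<le> 1"
proof -
  have "1 / sqrt (2 * pi) \<le> 1"
    using pi_ge_two by (simp add: divide_simps)
  then have "1 / sqrt (2 * pi) * exp (- x\<^sup>2 / 2) \<le> 1 * 1"
    by (intro mult_mono) auto
  then show ?thesis
    by (simp add: normal_density_def)
qed

lemma prob_space_rho0: "prob_space rho0"
  by (simp add: rho0_eq prob_space_normal_density)

text \<open>Polynomials are closed under composition with the cubic \<open>T h\<close>, so this one
  fact yields every moment needed for \<open>rho1 h\<close>, including the integral of
  \<open>U\<close>.\<close>

lemma integrable_rho0_poly: "integrable rho0 (poly p)"
proof -
  have "integrable lborel (\<lambda>x. \<Sum>i\<le>degree p. coeff p i * (std_normal_density x * x ^ i))"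
    using integrable_std_normal_moment by (intro Bochner_Integration.integrable_sum integrable_mult_right)
  also have "(\<lambda>x. \<Sum>i\<le>degree p. coeff p i * (std_normal_density x * x ^ i)) = (\<lambda>x. std_normal_density x * poly p x)"
    by (simp add: poly_altdef sum_distrib_left mult_ac)
  finally have "integrable lborel (\<lambda>x. std_normal_density x * poly p x)" .
  moreover have "poly p \<in> borel_measurable borel"
    by (intro borel_measurable_continuous_onI continuous_on_poly continuous_on_id)
  ultimately show ?thesis
    unfolding rho0_eq by (subst integrable_real_density) auto
qed

text \<open>Dropping the nonnegative quartic term from the exponent compares the density with a
  multiple of the Gaussian one.\<close>

lemma finite_measure_rho_star: "finite_measure rho_star"
proof -
  have "(\<integral>\<^sup>+x. ennreal (exp (- U x)) \<partial>lborel)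
      \<le> (\<integral>\<^sup>+x. ennreal (exp (- C0) * sqrt (2 * pi)) * ennreal (std_normal_density x) \<partial>lborel)"
  proof (intro nn_integral_mono)
    fix x :: real
    have "exp (- U x) \<le> exp (- C0) * exp (- x\<^sup>2 / 2)"
      by (simp add: U_def exp_add[symmetric])
    also have "\<dots> = exp (- C0) * sqrt (2 * pi) * std_normal_density x"
      by (simp add: normal_density_def)
    finally show "ennreal (exp (- U x)) \<le> ennreal (exp (- C0) * sqrt (2 * pi)) * ennreal (std_normal_density x)"
      by (simp add: ennreal_mult'[symmetric] ennreal_leI)
  qed
  also have "\<dots> = ennreal (exp (- C0) * sqrt (2 * pi)) * emeasure rho0 (space rho0)"
    by (subst nn_integral_cmult) (auto simp: rho0_eq emeasure_density)
  also have "\<dots> < \<infinity>"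
    using prob_space.emeasure_space_1[OF prob_space_rho0] by simp
  finally show ?thesis
    by (intro finite_measureI) (auto simp: rho_star_def emeasure_density)
qed

lemma sets_rho_star [simp]: "sets rho_star = sets borel"
  by (simp add: rho_star_def)

lemma density_rho_star:
  assumes [measurable]: "k \<in> borel_measurable borel" and "\<And>x. k x \<ge> 0"
  shows "density rho_star (\<lambda>x. ennreal (k x * exp (U x))) = density lborel (\<lambda>x. ennreal (k x))"
proof -
  have eq: "exp (- U x) * (k x * exp (U x)) = k x" for x
    by (simp add: exp_minus)
  show ?thesis
    unfolding rho_star_def by (subst density_density_eq) (auto simp: ennreal_mult'[symmetric] eq)
qed

text \<open>Relative to \<open>rho_star\<close> the density is \<open>k x * exp (U x)\<close>, with
  logarithm \<open>ln (k x) + U x\<close> wherever \<open>k x > 0\<close>. The divergence is thus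
  the expectation of that sum under the measure itself.\<close>

lemma rho_star_entropy:
  fixes k :: "real \<Rightarrow> real"
  assumes [measurable]: "k \<in> borel_measurable borel" and nonneg: "\<And>x. k x \<ge> 0"
    and int: "integrable (density lborel (\<lambda>x. ennreal (k x))) (\<lambda>x. ln (k x) + U x)"
  shows "integrable rho_star (\<lambda>x. (k x * exp (U x)) * ln (k x * exp (U x)))"
    and "F_KL (density lborel (\<lambda>x. ennreal (k x)))
      = ereal (\<integral>x. ln (k x) + U x \<partial>density lborel (\<lambda>x. ennreal (k x)))"
proof -
  have eq: "exp (- U x) * ((k x * exp (U x)) * ln (k x * exp (U x))) = k x * (ln (k x) + U x)" for x
    using nonneg[of x] by (cases "k x = 0") (auto simp: ln_mult exp_minus field_simps)
  have "integrable lborel (\<lambda>x. k x * (ln (k x) + U x))"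
    using int nonneg by (subst (asm) integrable_real_density) auto
  then show *: "integrable rho_star (\<lambda>x. (k x * exp (U x)) * ln (k x * exp (U x)))"
    unfolding rho_star_def by (subst integrable_real_density) (auto simp: eq)
  have "F_KL (density lborel (\<lambda>x. ennreal (k x)))
      = ereal (\<integral>x. (k x * exp (U x)) * ln (k x * exp (U x)) \<partial>rho_star)"
    unfolding F_KL_def density_rho_star[OF assms(1,2), symmetric]
    by (rule KL_density_eq) (use * nonneg finite_measure_rho_star in
      \<open>auto intro: finite_measure.sigma_finite_measure simp: rho_star_def\<close>)
  also have "(\<integral>x. (k x * exp (U x)) * ln (k x * exp (U x)) \<partial>rho_star) = (\<integral>x. k x * (ln (k x) + U x) \<partial>lborel)"
    unfolding rho_star_def by (subst integral_real_density) (auto simp: eq)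
  also have "\<dots> = (\<integral>x. ln (k x) + U x \<partial>density lborel (\<lambda>x. ennreal (k x)))"
    using nonneg by (subst integral_real_density) auto
  finally show "F_KL (density lborel (\<lambda>x. ennreal (k x)))
      = ereal (\<integral>x. ln (k x) + U x \<partial>density lborel (\<lambda>x. ennreal (k x)))" .
qed

text \<open>For \<open>k = exp (- V)\<close> this is the familiar formula
  \<open>1 + U - V\<close>.\<close>

lemma first_variation_F_KL:
  fixes k :: "real \<Rightarrow> real"
  assumes [measurable]: "k \<in> borel_measurable borel" and pos: "\<And>x. k x > 0"
    and prob: "prob_space (density lborel (\<lambda>x. ennreal (k x)))"
    and int: "integrable (density lborel (\<lambda>x. ennreal (k x))) (\<lambda>x. ln (k x) + U x)"
    and lower: "\<And>x. ln (k x) + U x \<ge> - (C * (1 + x\<^sup>2))"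
  shows "is_first_variation F_KL (density lborel (\<lambda>x. ennreal (k x))) (\<lambda>x. ereal (1 + (ln (k x) + U x)))"
proof -
  have *: "density lborel (\<lambda>x. ennreal (k x)) = density rho_star (\<lambda>x. ennreal (k x * exp (U x)))"
    by (rule density_rho_star[symmetric]) (use pos in \<open>auto intro: less_imp_le\<close>)
  have ln_eq: "ln (k x * exp (U x)) = ln (k x) + U x" for x
    using pos[of x] by (simp add: ln_mult)
  have "is_first_variation (\<lambda>\<mu>. KL \<mu> rho_star) (density rho_star (\<lambda>x. ennreal (k x * exp (U x))))
      (\<lambda>x. ereal (1 + ln (k x * exp (U x))))"
  proof (rule first_variation_KL[where C = C])
    show "prob_space (density rho_star (\<lambda>x. ennreal (k x * exp (U x))))"
      using prob * by simp
    show "integrable rho_star (\<lambda>x. (k x * exp (U x)) * ln (k x * exp (U x)))"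
      by (rule rho_star_entropy(1)) (use pos int in \<open>auto intro: less_imp_le\<close>)
    show "ln (k x * exp (U x)) \<ge> - (C * (1 + x\<^sup>2))" for x
      using lower[of x] by (simp add: ln_eq)
  qed (use pos finite_measure_rho_star in auto)
  then show ?thesis
    unfolding * F_KL_def[abs_def] ln_eq .
qed

lemma first_variation_rho0: "is_first_variation F_KL rho0 (\<lambda>x. ereal (1 + U x - V0 x))"
proof -
  \<comment> \<open>The difference of the two normalizing constants. The relative log-density is
    \<open>d + x ^ 4 / 4\<close>, hence at least \<open>- \<bar>d\<bar>\<close>, which gives the
    constant \<open>C\<close> below.\<close>
  define d where "d = C0 - ln (sqrt (2 * pi))"
  have eq: "ln (std_normal_density x) + U x = d + x ^ 4 / 4" for x
    unfolding exp_minus_V0[symmetric] by (simp add: U_def V0_def d_def)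
  have p: "d + x ^ 4 / 4 = poly [:d, 0, 0, 0, 1/4:] x" for x
    by (simp add: power4_eq_xxxx)
  have "is_first_variation F_KL (density lborel (\<lambda>x. ennreal (std_normal_density x)))
      (\<lambda>x. ereal (1 + (ln (std_normal_density x) + U x)))"
  proof (rule first_variation_F_KL[where C = "\<bar>d\<bar>"])
    show "prob_space (density lborel (\<lambda>x. ennreal (std_normal_density x)))"
      by (simp add: prob_space_normal_density)
    show "integrable (density lborel (\<lambda>x. ennreal (std_normal_density x))) (\<lambda>x. ln (std_normal_density x) + U x)"
      using integrable_rho0_poly[of "[:d, 0, 0, 0, 1/4:]"] by (simp only: rho0_eq eq p)
    show "- (\<bar>d\<bar> * (1 + x\<^sup>2)) \<le> ln (std_normal_density x) + U x" for x
    proof -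
      have "0 \<le> x ^ 4" "0 \<le> \<bar>d\<bar> * x\<^sup>2"
        by simp_all
      then show ?thesis
        unfolding eq distrib_left by linarith
    qed
  qed (auto simp: normal_density_pos)
  moreover have "ln (std_normal_density x) = - V0 x" for x
    by (simp add: exp_minus_V0[symmetric])
  ultimately show ?thesis
    by (simp add: rho0_eq algebra_simps)
qed

lemma gradient_U_minus_V0:
  "has_gradient (\<lambda>x. ereal (1 + U x - V0 x)) (deriv U x - deriv V0 x) x"
  unfolding has_gradient_def deriv_U_minus_deriv_V0
  using deriv_U[of x] deriv_V0[of x] by (auto intro!: derivative_eq_intros)

section \<open>The Euler iterate\<close>

definition dT :: "real \<Rightarrow> real \<Rightarrow> real" where
  "dT h x = 1 - 3 * h * x\<^sup>2"

definition crit :: "real \<Rightarrow> real" where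
  "crit h = 1 / sqrt (3 * h)"

text \<open>The value of \<open>T h\<close> at \<open>crit h\<close>: with
  \<open>3 * h * a\<^sup>2 = 1\<close>, \<open>a - h * a ^ 3\<close> is two thirds of
  \<open>a\<close>.\<close>

definition crit_val :: "real \<Rightarrow> real" where
  "crit_val h = 2 / 3 * crit h"

text \<open>For positive \<open>h\<close>, the intervals of strict monotonicity of
  \<open>T h\<close>, without the two fold points. The set of pieces serves as its own index
  set.\<close>

definition pieces :: "real \<Rightarrow> real set set" where
  "pieces h = {{..<- crit h}, {- crit h<..<crit h}, {crit h<..}}"

definition rho1_density :: "real \<Rightarrow> real \<Rightarrow> real" where
  "rho1_density h y = (\<Sum>J\<in>pieces h. branch_density std_normal_density (T h) (dT h) J y)"

lemma deriv_T: "(T h has_real_derivative dT h x) (at x)"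
  unfolding T_eq[abs_def] dT_def by (auto intro!: derivative_eq_intros simp: power2_eq_square)

lemma finite_pieces [simp]: "finite (pieces h)"
  by (simp add: pieces_def)

lemma card_pieces: "card (pieces h) \<le> 3"
  by (simp add: pieces_def card_insert_if)

lemma open_pieces: "J \<in> pieces h \<Longrightarrow> open J"
  by (auto simp: pieces_def)

lemma connected_pieces: "J \<in> pieces h \<Longrightarrow> connected J"
  by (auto simp: pieces_def)

lemma std_normal_density_differentiable: "std_normal_density differentiable at x"
proof -
  have "((\<lambda>x. exp (- V0 x)) has_real_derivative exp (- V0 x) * (- x)) (at x)"
    by (rule derivative_eq_intros deriv_V0 refl | simp)+
  then show ?thesis
    unfolding exp_minus_V0 by (auto simp: real_differentiable_def)
qed

lemma dT_differentiable: "dT h differentiable at x"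
proof -
  have "(dT h has_real_derivative - (3 * h * (2 * x))) (at x)"
    unfolding dT_def[abs_def] by (auto intro!: derivative_eq_intros)
  then show ?thesis
    by (auto simp: real_differentiable_def)
qed

lemma borel_measurable_dT [measurable]: "dT h \<in> borel_measurable borel"
  by (simp add: dT_def[abs_def])

section \<open>Geometry of the cubic fold and bounds on the density of the iterate\<close>

context
  fixes h :: real
  assumes h: "h > 0"
begin

lemma crit_pos: "crit h > 0"
  using h by (simp add: crit_def)

lemma crit_val_pos: "crit_val h > 0"
  using crit_pos by (simp add: crit_val_def)

lemma crit_sq: "3 * h * (crit h)\<^sup>2 = 1"
  using h by (simp add: crit_def power_divide)

lemma dT_eq: "dT h x = 3 * h * ((crit h)\<^sup>2 - x\<^sup>2)"
  using crit_sq by (simp add: dT_def algebra_simps)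

lemma dT_nonzero: "J \<in> pieces h \<Longrightarrow> x \<in> J \<Longrightarrow> dT h x \<noteq> 0"
  using h crit_pos by (auto simp: dT_eq pieces_def power2_eq_iff)

lemma AE_pieces: "AE x in lborel. x \<in> \<Union> (pieces h)"
proof -
  have "AE x in lborel. x \<notin> {- crit h, crit h}"
    by (intro AE_not_in finite_imp_null_set_lborel) simp
  then show ?thesis
    by eventually_elim (auto simp: pieces_def)
qed

lemma disjoint_pieces: "disjoint_family_on (\<lambda>J. J) (pieces h)"
  using crit_pos by (auto simp: disjoint_family_on_def pieces_def)

text \<open>With \<open>a = crit h\<close>, two distinct points of equal image satisfy
  \<open>x\<^sup>2 + x * y + y\<^sup>2 = 3 * a\<^sup>2\<close>. On the middle piece every summand is
  below \<open>a\<^sup>2\<close>, on an outer piece every summand is above it.\<close>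

lemma inj_on_T: "J \<in> pieces h \<Longrightarrow> inj_on (T h) J"
proof (rule inj_onI, rule ccontr)
  fix x y assume J: "J \<in> pieces h" and xy: "x \<in> J" "y \<in> J" "T h x = T h y" "x \<noteq> y"
  have "(x - y) * (3 * h * ((crit h)\<^sup>2 * 3) - 3 * h * (x\<^sup>2 + x * y + y\<^sup>2)) = 3 * (T h x - T h y)"
    using crit_sq by (simp add: T_eq mult.assoc[symmetric]) (simp add: algebra_simps power2_eq_square power3_eq_cube)
  then have "3 * h * ((crit h)\<^sup>2 * 3) = 3 * h * (x\<^sup>2 + x * y + y\<^sup>2)"
    using xy by simp
  then have eq: "3 * (crit h)\<^sup>2 = x\<^sup>2 + x * y + y\<^sup>2"
    using h by simp
  from J consider "\<bar>x\<bar> < crit h" "\<bar>y\<bar> < crit h" | "x > crit h" "y > crit h" | "- x > crit h" "- y > crit h"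
    using xy by (auto simp: pieces_def)
  then show False
  proof cases
    case 1
    then have "\<bar>x\<bar> * \<bar>x\<bar> < crit h * crit h" "\<bar>y\<bar> * \<bar>y\<bar> < crit h * crit h" "\<bar>x\<bar> * \<bar>y\<bar> < crit h * crit h"
      using mult_strict_mono'[OF 1(1) 1(1)] mult_strict_mono'[OF 1(2) 1(2)] mult_strict_mono'[OF 1] by auto
    moreover have "x * y \<le> \<bar>x\<bar> * \<bar>y\<bar>"
      by (simp add: abs_mult[symmetric])
    ultimately show False
      using eq by (simp add: power2_eq_square)
  next
    case 2
    then have "x * x > crit h * crit h" "y * y > crit h * crit h" "x * y > crit h * crit h"
      using crit_pos by (auto intro!: mult_strict_mono')
    then show False
      using eq by (simp add: power2_eq_square)
  next
    case 3
    then have "x * x > crit h * crit h" "y * y > crit h * crit h" "x * y > crit h * crit h"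
      using mult_strict_mono'[OF 3(1) 3(1)] mult_strict_mono'[OF 3(2) 3(2)] mult_strict_mono'[OF 3] crit_pos by auto
    then show False
      using eq by (simp add: power2_eq_square)
  qed
qed

text \<open>Up to constants, this writes the discriminant of \<open>T h x = y\<close> as \<open>(dT h x)\<^sup>2\<close> times the discriminant of
  the quadratic left after splitting off the root \<open>x\<close>. It bounds \<open>\<bar>dT h x\<bar>\<close> from below in terms of \<open>y\<close>
  alone, uniformly over all preimages.\<close>

lemma crit_val_sq_minus_T_sq: "9 * ((crit_val h)\<^sup>2 - (T h x)\<^sup>2) = (dT h x)\<^sup>2 * (4 * (crit h)\<^sup>2 - x\<^sup>2)"
  using crit_sq unfolding crit_val_def T_eq dT_def by algebra

text \<open>The cubic has a double root at the fold point and a simple root at minus twice that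
  point; the double root is the source of the square-root singularity.\<close>

lemma crit_val_minus_T: "crit_val h - T h x = h * (x - crit h)\<^sup>2 * (x + 2 * crit h)"
  using crit_sq unfolding crit_val_def T_eq by algebra

text \<open>Besides its double root, each critical value has a simple preimage, which lies on an
  outer piece. This keeps the density positive even at the critical values.\<close>

lemma T_2crit: "T h (2 * crit h) = - crit_val h" "T h (- 2 * crit h) = crit_val h"
  "T h (crit h) = crit_val h" "T h (- crit h) = - crit_val h"
  using crit_sq unfolding crit_val_def T_eq by algebra+

text \<open>Beyond the critical values the discriminant identity forces
  \<open>\<bar>x\<bar> \<ge> 2 * crit h\<close>, so
  \<open>3 * h * x\<^sup>2 \<ge> 4\<close>.\<close>

lemma abs_dT_ge_3:
  assumes "J \<in> pieces h" "x \<in> J" "\<bar>T h x\<bar> \<ge> crit_val h"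
  shows "\<bar>dT h x\<bar> \<ge> 3"
proof -
  have "(crit_val h)\<^sup>2 \<le> (T h x)\<^sup>2"
    using assms(3) crit_val_pos by (simp add: abs_le_square_iff[symmetric])
  then have "(dT h x)\<^sup>2 * (4 * (crit h)\<^sup>2 - x\<^sup>2) \<le> 0"
    unfolding crit_val_sq_minus_T_sq[symmetric] by simp
  then have "4 * (crit h)\<^sup>2 - x\<^sup>2 \<le> 0"
    using dT_nonzero[OF assms(1,2)] by (simp add: mult_le_0_iff)
  then have "3 * h * (4 * (crit h)\<^sup>2) \<le> 3 * h * x\<^sup>2"
    using h by simp
  then show ?thesis
    using crit_sq by (simp add: dT_def)
qed

text \<open>Discard \<open>- x\<^sup>2\<close> in the discriminant identity and use
  \<open>4 * (crit h)\<^sup>2 = 9 * (crit_val h)\<^sup>2\<close>.\<close>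

lemma abs_dT_ge_sqrt:
  assumes "J \<in> pieces h" "x \<in> J" "\<bar>T h x\<bar> < crit_val h"
  shows "\<bar>dT h x\<bar> * crit_val h \<ge> sqrt ((crit_val h)\<^sup>2 - (T h x)\<^sup>2)"
proof -
  have "9 * ((crit_val h)\<^sup>2 - (T h x)\<^sup>2) \<le> (dT h x)\<^sup>2 * (4 * (crit h)\<^sup>2)"
    unfolding crit_val_sq_minus_T_sq by (intro mult_left_mono) auto
  then have "(crit_val h)\<^sup>2 - (T h x)\<^sup>2 \<le> (\<bar>dT h x\<bar> * crit_val h)\<^sup>2"
    by (simp add: crit_val_def power_mult_distrib power_divide)
  then show ?thesis
    using crit_val_pos by (intro real_le_lsqrt) auto
qed

lemma rho1_density_nonneg: "rho1_density h y \<ge> 0"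
  unfolding rho1_density_def by (intro sum_nonneg branch_density_nonneg) (rule normal_density_nonneg)

text \<open>There are at most three preimages, one per piece, and the Gaussian density is at most
  1.\<close>

lemma rho1_density_le:
  assumes "B \<ge> 0" "\<And>J x. J \<in> pieces h \<Longrightarrow> x \<in> J \<Longrightarrow> T h x = y \<Longrightarrow> 1 / \<bar>dT h x\<bar> \<le> B"
  shows "rho1_density h y \<le> 3 * B"
proof -
  have "branch_density std_normal_density (T h) (dT h) J y \<le> B" if "J \<in> pieces h" for J
  proof (cases "y \<in> T h ` J")
    case True
    then obtain x where x: "x \<in> J" "y = T h x"
      by blast
    then have "branch_density std_normal_density (T h) (dT h) J y = std_normal_density x / \<bar>dT h x\<bar>"
      using branch_density_image[OF inj_on_T[OF that]] by simp
    also have "\<dots> \<le> 1 / \<bar>dT h x\<bar>"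
      by (intro divide_right_mono std_normal_density_le_1) simp
    also have "\<dots> \<le> B"
      using assms(2)[OF that] x by simp
    finally show ?thesis .
  qed (simp add: branch_density_outside assms(1))
  then have "rho1_density h y \<le> (\<Sum>J\<in>pieces h. B)"
    unfolding rho1_density_def by (intro sum_mono)
  also have "\<dots> \<le> 3 * B"
    using card_pieces[of h] assms(1) by (simp add: mult_right_mono)
  finally show ?thesis .
qed

lemma rho1_density_le_1: "\<bar>y\<bar> \<ge> crit_val h \<Longrightarrow> rho1_density h y \<le> 1"
  using rho1_density_le[of "1/3" y] abs_dT_ge_3 by (force simp: divide_simps)

lemma rho1_density_le_sqrt:
  assumes "\<bar>y\<bar> < crit_val h"
  shows "rho1_density h y \<le> 3 * (crit_val h / sqrt ((crit_val h)\<^sup>2 - y\<^sup>2))"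
proof (rule rho1_density_le)
  have pos: "(crit_val h)\<^sup>2 - y\<^sup>2 > 0"
    using power_strict_mono[OF assms, of 2] by simp
  show "crit_val h / sqrt ((crit_val h)\<^sup>2 - y\<^sup>2) \<ge> 0"
    using crit_val_pos pos by simp
  fix J x assume x: "J \<in> pieces h" "x \<in> J" "T h x = y"
  then show "1 / \<bar>dT h x\<bar> \<le> crit_val h / sqrt ((crit_val h)\<^sup>2 - y\<^sup>2)"
    using abs_dT_ge_sqrt[OF x(1,2)] dT_nonzero[OF x(1,2)] pos assms by (simp add: divide_simps mult.commute)
qed

lemma T_surj: "\<exists>J\<in>pieces h. \<exists>x\<in>J. T h x = y"
proof -
  have "\<exists>x. T h x = y"
  proof -
    \<comment> \<open>From \<open>M \<ge> 1\<close> and \<open>h * M \<ge> 2\<close> follows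
      \<open>h * M ^ 3 \<ge> 2 * M\<close>, so
      \<open>T h M \<le> - M \<le> y \<le> M \<le> T h (- M)\<close>.\<close>
    define M where "M = 1 + \<bar>y\<bar> + 2 / h"
    have M: "M \<ge> 1" "M > 0" "h * M \<ge> 2"
      using h by (auto simp: M_def algebra_simps add_pos_nonneg)
    have "h * M * (M * M) \<ge> 2 * (M * M)" "M * M \<ge> M"
      using M by (auto intro: mult_right_mono)
    then have "h * M ^ 3 \<ge> 2 * M"
      by (simp add: power3_eq_cube mult_ac)
    moreover have "M \<ge> \<bar>y\<bar>"
      using h by (simp add: M_def)
    ultimately have "T h M \<le> y" "y \<le> T h (- M)"
      unfolding T_eq power_minus_odd[OF odd_numeral] by auto
    moreover have "\<forall>x. isCont (T h) x"
      using deriv_T by (auto intro: DERIV_isCont)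
    ultimately show ?thesis
      using IVT2[of "T h" M y "- M"] M by auto
  qed
  then obtain x where x: "T h x = y"
    by blast
  consider "x \<in> \<Union> (pieces h)" | "x = crit h" | "x = - crit h"
    by (auto simp: pieces_def) linarith+
  then show ?thesis
  proof cases
    case 2
    then show ?thesis
      using x T_2crit crit_pos by (intro bexI[of _ "{..<- crit h}"] bexI[of _ "- 2 * crit h"]) (auto simp: pieces_def)
  next
    case 3
    then show ?thesis
      using x T_2crit crit_pos by (intro bexI[of _ "{crit h<..}"] bexI[of _ "2 * crit h"]) (auto simp: pieces_def)
  qed (use x in auto)
qed

lemma rho1_density_lower:
  obtains x where "T h x = y" "dT h x \<noteq> 0" "rho1_density h y \<ge> std_normal_density x / \<bar>dT h x\<bar>"
proof -
  obtain J x where x: "J \<in> pieces h" "x \<in> J" "T h x = y"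
    using T_surj by blast
  have "std_normal_density x / \<bar>dT h x\<bar> = branch_density std_normal_density (T h) (dT h) J y"
    using branch_density_image[OF inj_on_T[OF x(1)] x(2)] x(3) by simp
  also have "\<dots> \<le> rho1_density h y"
    unfolding rho1_density_def
    by (rule member_le_sum) (use x in \<open>auto intro!: branch_density_nonneg normal_density_nonneg\<close>)
  finally show ?thesis
    using that x dT_nonzero by blast
qed

lemma rho1_density_pos: "rho1_density h y > 0"
  using rho1_density_lower[of y] normal_density_pos[of 1 0]
  by (metis divide_pos_pos less_le_trans zero_less_abs_iff zero_less_one)

text \<open>A single preimage \<open>x\<close> of \<open>y\<close> already suffices: its Gaussian
  weight and \<open>ln \<bar>dT h x\<bar>\<close> cost at most a constant plus a multiple of
  \<open>x\<^sup>2\<close>, and cubic growth of \<open>T h\<close> bounds \<open>x\<^sup>2\<close>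
  by \<open>y\<^sup>2\<close> plus a constant.\<close>

lemma ln_rho1_density_ge: "\<exists>C\<ge>0. \<forall>y. ln (rho1_density h y) \<ge> - (C * (1 + y\<^sup>2))"
proof (intro exI conjI allI)
  \<comment> \<open>\<open>1 / 2\<close> is the Gaussian exponent, \<open>3 * h\<close> comes from
    \<open>ln \<bar>dT h x\<bar> \<le> 3 * h * x\<^sup>2\<close>, and \<open>1 + 2 / h\<close> from
    \<open>x\<^sup>2 \<le> y\<^sup>2 + 2 / h\<close>.\<close>
  define C where "C = ln (sqrt (2 * pi)) + 1 + (1 / 2 + 3 * h) * (1 + 2 / h)"
  have ln_nonneg: "ln (sqrt (2 * pi)) \<ge> 0"
    using pi_ge_two by simp
  show "C \<ge> 0"
    using h ln_nonneg by (auto simp: C_def)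
  fix y
  obtain x where x: "T h x = y" "dT h x \<noteq> 0" "rho1_density h y \<ge> std_normal_density x / \<bar>dT h x\<bar>"
    using rho1_density_lower by blast
  \<comment> \<open>Once \<open>h * x\<^sup>2 > 2\<close>, the factor in
    \<open>y = x * (1 - h * x\<^sup>2)\<close> has modulus at least 1, so
    \<open>\<bar>y\<bar> \<ge> \<bar>x\<bar>\<close>.\<close>
  have sq: "x\<^sup>2 \<le> y\<^sup>2 + 2 / h"
  proof (cases "x\<^sup>2 \<le> 2 / h")
    case False
    then have "h * x\<^sup>2 - 1 \<ge> 1"
      using h by (simp add: field_simps)
    then have "x\<^sup>2 * 1 \<le> x\<^sup>2 * (h * x\<^sup>2 - 1)\<^sup>2"
      by (intro mult_left_mono) auto
    also have "\<dots> = y\<^sup>2"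
      unfolding x(1)[symmetric] T_eq by (simp add: power2_eq_square power3_eq_cube algebra_simps)
    finally show ?thesis
      using h by (simp add: add_increasing2)
  qed (simp add: add_increasing)
  have "\<bar>dT h x\<bar> \<le> 1 + 3 * h * x\<^sup>2"
    using h by (simp add: dT_def abs_le_iff)
  moreover have "ln \<bar>dT h x\<bar> \<le> \<bar>dT h x\<bar> - 1"
    using x(2) by (intro ln_le_minus_one) simp
  ultimately have ln_dT: "ln \<bar>dT h x\<bar> \<le> 3 * h * x\<^sup>2"
    by linarith
  have "ln (std_normal_density x / \<bar>dT h x\<bar>) = - V0 x - ln \<bar>dT h x\<bar>"
    using x(2) by (simp add: exp_minus_V0[symmetric] ln_div)
  then have "ln (std_normal_density x / \<bar>dT h x\<bar>) \<ge> - ln (sqrt (2 * pi)) - (1 / 2 + 3 * h) * x\<^sup>2"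
    using ln_dT by (simp add: V0_def algebra_simps)
  moreover have "ln (std_normal_density x / \<bar>dT h x\<bar>) \<le> ln (rho1_density h y)"
    using x normal_density_pos[of 1 0 x] by (intro ln_mono) auto
  moreover have "(1 / 2 + 3 * h) * x\<^sup>2 \<le> (1 / 2 + 3 * h) * (1 + 2 / h) * (1 + y\<^sup>2)"
  proof -
    have "y\<^sup>2 + 2 / h \<le> (1 + 2 / h) * (1 + y\<^sup>2)"
      using h by (simp add: algebra_simps)
    then show ?thesis
      using sq h by (simp add: mult.assoc mult_left_mono)
  qed
  moreover have "ln (sqrt (2 * pi)) * 1 \<le> ln (sqrt (2 * pi)) * (1 + y\<^sup>2)"
    using ln_nonneg by (intro mult_left_mono) auto
  ultimately show "ln (rho1_density h y) \<ge> - (C * (1 + y\<^sup>2))"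
    by (simp add: C_def distrib_right) (smt (verit) zero_le_power2)
qed

lemma borel_measurable_rho1_density [measurable]: "rho1_density h \<in> borel_measurable borel"
proof -
  have "branch_density std_normal_density (T h) (dT h) J \<in> borel_measurable borel" if "J \<in> pieces h" for J
    using open_pieces inj_on_T deriv_T dT_nonzero that by (intro borel_measurable_branch_density) auto
  then show ?thesis
    unfolding rho1_density_def[abs_def] by (intro borel_measurable_sum)
qed

lemma rho1_eq: "rho1 h = density lborel (\<lambda>y. ennreal (rho1_density h y))"
  unfolding rho1_def rho0_eq rho1_density_def
proof (rule distr_density_branches[where t' = "dT h"])
  show "AE x in lborel. x \<in> (\<Union>J\<in>pieces h. J)"
    using AE_pieces by simp
  show "J \<in> sets borel" if "J \<in> pieces h" for J
    using open_pieces[OF that] by auto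
  show "branch_density std_normal_density (T h) (dT h) J \<in> borel_measurable borel" if "J \<in> pieces h" for J
    using open_pieces inj_on_T deriv_T dT_nonzero that by (intro borel_measurable_branch_density) auto
  show "branch_density std_normal_density (T h) (dT h) J (T h x) * \<bar>dT h x\<bar> = std_normal_density x"
    if "J \<in> pieces h" "x \<in> J" for J x
    using that inj_on_T dT_nonzero by (simp add: branch_density_image)
qed (use disjoint_pieces inj_on_T deriv_T in \<open>auto simp: branch_density_nonneg branch_density_outside\<close>)

lemma AE_differentiable_rho1_density: "AE y in lborel. rho1_density h differentiable at y"
proof -
  have "AE y in lborel. \<forall>J\<in>pieces h. branch_density std_normal_density (T h) (dT h) J differentiable at y"
    using open_pieces connected_pieces inj_on_T deriv_T dT_nonzero
    by (intro AE_finite_allI AE_differentiable_branch_density)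
       (auto simp: std_normal_density_differentiable dT_differentiable)
  then show ?thesis
    unfolding rho1_density_def[abs_def] by eventually_elim (auto intro: differentiable_sum)
qed

lemma prob_space_rho1: "prob_space (rho1 h)"
  unfolding rho1_def using prob_space_rho0
  by (intro prob_space.prob_space_distr) (simp_all add: rho0_def)

lemma sets_rho1 [simp]: "sets (rho1 h) = sets borel"
  by (simp add: rho1_def)

lemma integrable_rho1_poly: "integrable (rho1 h) (poly p)"
proof -
  have "(\<lambda>x. poly p (T h x)) = poly (pcompose p [:0, 1, 0, - h:])"
    by (auto simp: poly_pcompose T_eq algebra_simps power3_eq_cube)
  then have "integrable rho0 (\<lambda>x. poly p (T h x))"
    using integrable_rho0_poly by simp
  moreover have "poly p \<in> borel_measurable borel"
    by (intro borel_measurable_continuous_onI continuous_on_poly continuous_on_id)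
  ultimately show ?thesis
    unfolding rho1_def by (subst integrable_distr_eq) (auto simp: rho0_def)
qed

lemma integrable_rho1_sq: "integrable (rho1 h) (\<lambda>x. x\<^sup>2)"
proof -
  have "(\<lambda>x::real. x\<^sup>2) = poly [:0, 0, 1:]"
    by (auto simp: power2_eq_square)
  then show ?thesis
    by (metis integrable_rho1_poly)
qed

lemma integrable_rho1_U: "integrable (rho1 h) U"
proof -
  have "U = poly [:C0, 0, 1/2, 0, 1/4:]"
    by (auto simp: U_def algebra_simps power2_eq_square power4_eq_xxxx)
  then show ?thesis
    by (metis integrable_rho1_poly)
qed

lemma rho1_P2: "rho1 h \<in> P2"
  by (simp add: P2_def prob_space_rho1 integrable_rho1_sq)

end

text \<open>The logarithm is traded for half a power. A density of order
  \<open>s powr (- 1 / 2)\<close> then gives \<open>s powr (- 3 / 4)\<close>, still integrable; any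
  exponent strictly between 1 and 2 would serve in place of \<open>3 / 2\<close>.\<close>

lemma xlnx_le_powr: "x * ln x \<le> 2 * x powr (3 / 2)" if "x > 0" for x :: real
proof -
  have "ln (x powr (1 / 2)) \<le> x powr (1 / 2) - 1"
    using that by (intro ln_le_minus_one) auto
  then have "ln x \<le> 2 * x powr (1 / 2)"
    using that by (simp add: ln_powr)
  then have "x * ln x \<le> x * (2 * x powr (1 / 2))"
    using that by (intro mult_left_mono) auto
  also have "x * (2 * x powr (1 / 2)) = 2 * x powr (3 / 2)"
    using that powr_add[of x 1 "1 / 2"] by simp
  finally show ?thesis .
qed

text \<open>The explicit antiderivative \<open>?F\<close> extends continuously to both singular end
  points, so its increment is finite.\<close>

lemma set_integrable_inverse_sqrt_powr:
  fixes c :: real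
  assumes c: "c > 0"
  shows "set_integrable lborel {- c<..<c} (\<lambda>y. (c - y) powr (- 3 / 4) + (c + y) powr (- 3 / 4))"
proof -
  let ?F = "\<lambda>y. 4 * (c + y) powr (1 / 4) - 4 * (c - y) powr (1 / 4)"
  have "set_integrable lborel (einterval (ereal (- c)) (ereal c)) (\<lambda>y. (c - y) powr (- 3 / 4) + (c + y) powr (- 3 / 4))"
  proof (rule interval_integral_FTC_nonneg)
    show "ereal (- c) < ereal c"
      using c by simp
    show "(?F has_real_derivative (c - y) powr (- 3 / 4) + (c + y) powr (- 3 / 4)) (at y)"
      if "ereal (- c) < ereal y" "ereal y < ereal c" for y
      using that by (auto intro!: derivative_eq_intros)
    show "isCont (\<lambda>y. (c - y) powr (- 3 / 4) + (c + y) powr (- 3 / 4)) y"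
      if "ereal (- c) < ereal y" "ereal y < ereal c" for y
      using that by (auto intro!: continuous_intros)
    have cont: "continuous_on {- c..c} ?F"
      by (intro continuous_on_diff continuous_on_mult continuous_on_powr' continuous_on_add
          continuous_on_const continuous_on_id) auto
    have "(?F \<longlongrightarrow> ?F (- c)) (at_right (- c))"
      by (rule continuous_on_Icc_at_rightD[OF cont]) (use c in simp)
    then show "((?F \<circ> real_of_ereal) \<longlongrightarrow> ?F (- c)) (at_right (ereal (- c)))"
      by (simp add: ereal_tendsto_simps)
    have "(?F \<longlongrightarrow> ?F c) (at_left c)"
      by (rule continuous_on_Icc_at_leftD[OF cont]) (use c in simp)
    then show "((?F \<circ> real_of_ereal) \<longlongrightarrow> ?F c) (at_left (ereal c))"
      by (simp add: ereal_tendsto_simps)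
  qed auto
  then show ?thesis
    by (simp add: einterval_eq)
qed

text \<open>The common source of contradiction for a continuous density and for a Wasserstein
  gradient: mass of order \<open>sqrt \<delta>\<close> against a linear bound.\<close>

lemma sqrt_not_le_linear:
  fixes \<kappa> M d :: real
  assumes "\<kappa> > 0" "d > 0"
  obtains \<delta> where "0 < \<delta>" "\<delta> < d" "M * \<delta> < \<kappa> * sqrt \<delta>"
proof -
  define N where "N = 1 + \<bar>M\<bar>"
  have N: "N > 0" "M < N"
    by (auto simp: N_def)
  \<comment> \<open>At \<open>(\<kappa> / N)\<^sup>2\<close> the functions
    \<open>N * \<delta>\<close> and \<open>\<kappa> * sqrt \<delta>\<close> meet; strictness comes
    from \<open>M < N\<close>.\<close>
  define \<delta> where "\<delta> = min (d / 2) ((\<kappa> / N)\<^sup>2)"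
  have \<delta>: "\<delta> > 0" "\<delta> < d"
    using assms N by (auto simp: \<delta>_def min_def)
  have "sqrt \<delta> \<le> \<kappa> / N"
    using assms N by (auto intro!: real_le_lsqrt simp: \<delta>_def)
  then have "N * sqrt \<delta> \<le> \<kappa>"
    using N by (simp add: field_simps)
  then have "N * sqrt \<delta> * sqrt \<delta> \<le> \<kappa> * sqrt \<delta>"
    using \<delta> by (intro mult_right_mono) auto
  then have "N * \<delta> \<le> \<kappa> * sqrt \<delta>"
    using \<delta> by (simp add: mult.assoc)
  moreover have "M * \<delta> < N * \<delta>"
    using N \<delta> by simp
  ultimately have "M * \<delta> < \<kappa> * sqrt \<delta>"
    by (rule less_le_trans[rotated])
  with \<delta> show ?thesis
    by (rule that)
qed

section \<open>Finite entropy, first variation and mass near the critical value\<close>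

context
  fixes h :: real
  assumes h: "h > 0"
begin

text \<open>The quadratic lower bound on the logarithm and the second moment control the integrand
  from below. From above, it is nonpositive where the density is at most 1, in particular outside
  the critical values, and between them the \<open>3 / 2\<close> power applies.\<close>

lemma integrable_rho1_density_entropy: "integrable lborel (\<lambda>y. rho1_density h y * ln (rho1_density h y))"
proof -
  define c where "c = crit_val h"
  have c: "c > 0"
    using crit_val_pos[OF h] by (simp add: c_def)
  note [measurable] = borel_measurable_rho1_density[OF h]
  obtain C where C: "C \<ge> 0" "\<And>y. ln (rho1_density h y) \<ge> - (C * (1 + y\<^sup>2))"
    using ln_rho1_density_ge[OF h] by blast
  \<comment> \<open>The factors come from \<open>xlnx_le_powr\<close>, from the square-root bound on
    the density, and from splitting the two singularities.\<close>
  define K where "K = 2 * ((3 * c) powr (3 / 2) * c powr (- 3 / 4))"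
  define B where "B y = indicator {- c<..<c} y *\<^sub>R (K * ((c - y) powr (- 3 / 4) + (c + y) powr (- 3 / 4)))" for y
  show ?thesis
  proof (rule integrable_between[where g = "\<lambda>y. rho1_density h y * - (C * (1 + y\<^sup>2))" and h = B])
    show "integrable lborel B"
      using set_integrable_mult_right[OF set_integrable_inverse_sqrt_powr[OF c], of K]
      unfolding set_integrable_def B_def by simp
    have "integrable (rho1 h) (\<lambda>y. - (C * (1 + y\<^sup>2)))"
      using integrable_rho1_sq[OF h] prob_space_rho1[OF h]
      by (auto intro!: integrable_minus integrable_mult_right Bochner_Integration.integrable_add
          simp: prob_space.finite_measure finite_measure.integrable_const)
    then show "integrable lborel (\<lambda>y. rho1_density h y * - (C * (1 + y\<^sup>2)))"
      unfolding rho1_eq[OF h] using rho1_density_nonneg[OF h] by (subst (asm) integrable_real_density) auto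
    show "AE y in lborel. rho1_density h y * - (C * (1 + y\<^sup>2)) \<le> rho1_density h y * ln (rho1_density h y)"
      using C(2) rho1_density_nonneg[OF h] by (intro AE_I2 mult_left_mono) auto
    have "rho1_density h y * ln (rho1_density h y) \<le> B y" for y
    proof (cases "rho1_density h y \<le> 1")
      case True
      then have "rho1_density h y * ln (rho1_density h y) \<le> 0"
        using rho1_density_pos[OF h, of y] by (intro mult_nonneg_nonpos) auto
      also have "\<dots> \<le> B y"
        by (simp add: B_def K_def)
      finally show ?thesis .
    next
      case False
      then have y: "\<bar>y\<bar> < c"
        using rho1_density_le_1[OF h, of y] unfolding c_def not_le[symmetric] by blast
      define s where "s = c\<^sup>2 - y\<^sup>2"
      have s: "s = (c - y) * (c + y)"
        by (simp add: s_def power2_eq_square algebra_simps)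
      have "s > 0"
        unfolding s using y by (intro mult_pos_pos) auto
      \<comment> \<open>One of the factors \<open>c - y\<close> and \<open>c + y\<close> is at least
        \<open>c\<close>, so the product of singular powers is bounded by a multiple of their
        sum.\<close>
      have s_powr: "s powr (- 3 / 4) \<le> c powr (- 3 / 4) * ((c - y) powr (- 3 / 4) + (c + y) powr (- 3 / 4))"
      proof -
        have eq: "s powr (- 3 / 4) = (c - y) powr (- 3 / 4) * (c + y) powr (- 3 / 4)"
          unfolding s using y by (intro powr_mult)
        show ?thesis
        proof (cases "y \<ge> 0")
          case True
          then have "(c + y) powr (- 3 / 4) \<le> c powr (- 3 / 4)"
            using c by (intro powr_mono2') auto
          then have "s powr (- 3 / 4) \<le> (c - y) powr (- 3 / 4) * c powr (- 3 / 4)"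
            unfolding eq by (intro mult_left_mono) auto
          then show ?thesis
            by (simp add: distrib_left mult.commute add_increasing2)
        next
          case False
          then have "(c - y) powr (- 3 / 4) \<le> c powr (- 3 / 4)"
            using c by (intro powr_mono2') auto
          then have "s powr (- 3 / 4) \<le> c powr (- 3 / 4) * (c + y) powr (- 3 / 4)"
            unfolding eq by (intro mult_right_mono) auto
          then show ?thesis
            by (simp add: distrib_left add_increasing)
        qed
      qed
      have "rho1_density h y * ln (rho1_density h y) \<le> 2 * rho1_density h y powr (3 / 2)"
        using rho1_density_pos[OF h] by (rule xlnx_le_powr)
      also have "\<dots> \<le> 2 * (3 * (c / sqrt s)) powr (3 / 2)"
        using rho1_density_le_sqrt[OF h, of y] y rho1_density_nonneg[OF h, of y]
        by (intro mult_left_mono powr_mono2) (auto simp: c_def s_def)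
      also have "(3 * (c / sqrt s)) powr (3 / 2) = (3 * c) powr (3 / 2) * s powr (- 3 / 4)"
      proof -
        have "3 * (c / sqrt s) = (3 * c) * s powr - (1 / 2)"
          using \<open>s > 0\<close> by (simp only: powr_minus_divide powr_half_sqrt) simp
        then have "(3 * (c / sqrt s)) powr (3 / 2) = (3 * c) powr (3 / 2) * (s powr - (1 / 2)) powr (3 / 2)"
          using c by (simp only: powr_mult)
        then show ?thesis
          by (simp only: powr_powr) simp
      qed
      also have "2 * ((3 * c) powr (3 / 2) * s powr (- 3 / 4))
          \<le> 2 * ((3 * c) powr (3 / 2) * (c powr (- 3 / 4) * ((c - y) powr (- 3 / 4) + (c + y) powr (- 3 / 4))))"
        using s_powr by (intro mult_left_mono) auto
      also have "\<dots> = B y"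
        using y by (simp add: B_def K_def indicator_def abs_less_iff)
      finally show ?thesis .
    qed
    then show "AE y in lborel. rho1_density h y * ln (rho1_density h y) \<le> B y"
      by simp
  qed measurable
qed

lemma integrable_rho1_ln_density: "integrable (rho1 h) (\<lambda>y. ln (rho1_density h y))"
  unfolding rho1_eq[OF h] using integrable_rho1_density_entropy borel_measurable_rho1_density[OF h] rho1_density_nonneg[OF h]
  by (subst integrable_real_density) auto

lemma integrable_rho1_entropy: "integrable (rho1 h) (\<lambda>y. ln (rho1_density h y) + U y)"
  using integrable_rho1_ln_density integrable_rho1_U[OF h] by simp

lemma F_KL_rho1: "F_KL (rho1 h) = ereal (\<integral>y. ln (rho1_density h y) + U y \<partial>rho1 h)"
  unfolding rho1_eq[OF h]
  by (rule rho_star_entropy(2))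
     (use integrable_rho1_entropy borel_measurable_rho1_density[OF h] rho1_density_nonneg[OF h] in \<open>auto simp: rho1_eq[OF h]\<close>)

lemma rho1_eff_domain: "rho1 h \<in> eff_domain F_KL"
  by (simp add: eff_domain_def rho1_P2[OF h] F_KL_rho1)

lemma rho1_S_f: "rho1 h \<in> S_f F_KL"
proof -
  obtain C where C: "C \<ge> 0" "\<And>y. ln (rho1_density h y) \<ge> - (C * (1 + y\<^sup>2))"
    using ln_rho1_density_ge[OF h] by blast
  have lower: "ln (rho1_density h x) + U x \<ge> - ((C + \<bar>C0\<bar>) * (1 + x\<^sup>2))" for x
  proof -
    have "- (\<bar>C0\<bar> * (1 + x\<^sup>2)) \<le> - \<bar>C0\<bar>"
      by (simp add: distrib_left)
    also have "\<dots> \<le> C0"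
      by simp
    also have "\<dots> \<le> U x"
      by (simp add: U_def)
    finally show ?thesis
      using C(2)[of x] unfolding distrib_right by linarith
  qed
  have "is_first_variation F_KL (rho1 h) (\<lambda>x. ereal (1 + (ln (rho1_density h x) + U x)))"
    unfolding rho1_eq[OF h]
    by (rule first_variation_F_KL[OF _ _ _ _ lower])
       (use integrable_rho1_entropy prob_space_rho1[OF h] borel_measurable_rho1_density[OF h] rho1_density_pos[OF h]
        in \<open>auto simp: rho1_eq[OF h]\<close>)
  moreover have "AE x in rho1 h. \<exists>D. has_gradient (\<lambda>x. ereal (1 + (ln (rho1_density h x) + U x))) D x"
  proof -
    have "\<exists>D. has_gradient (\<lambda>x. ereal (1 + (ln (rho1_density h x) + U x))) D x"
      if diff: "rho1_density h differentiable at x" for x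
    proof -
      obtain D where "(rho1_density h has_real_derivative D) (at x)"
        using diff by (auto simp: real_differentiable_def)
      then have "((\<lambda>x. 1 + (ln (rho1_density h x) + U x)) has_real_derivative D / rho1_density h x + (x + x ^ 3)) (at x)"
        using rho1_density_pos[OF h, of x] deriv_U[of x] by (auto intro!: derivative_eq_intros)
      then show ?thesis
        by (auto simp: has_gradient_def)
    qed
    then have "AE x in lborel. \<exists>D. has_gradient (\<lambda>x. ereal (1 + (ln (rho1_density h x) + U x))) D x"
      using AE_differentiable_rho1_density[OF h] by (auto elim: eventually_mono)
    then show ?thesis
      unfolding rho1_eq[OF h] using borel_measurable_rho1_density[OF h] by (subst AE_density) auto
  qed
  ultimately show ?thesis
    using rho1_eff_domain by (auto simp: S_f_def)
qed

lemma rho1_absolutely_continuous: "absolutely_continuous lborel (rho1 h)"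
  unfolding rho1_eq[OF h] using borel_measurable_rho1_density[OF h] by (intro absolutely_continuousI_density) auto

text \<open>Because of the double root, points within \<open>sqrt (crit h * \<delta>)\<close> to the
  left of the fold land within \<open>\<delta>\<close> to the left of \<open>crit_val h\<close>.
  They lie between 0 and \<open>crit h\<close>, where the Gaussian density is at least its value at
  \<open>crit h\<close>.\<close>

lemma rho1_mass_left:
  assumes "0 < \<delta>" "\<delta> < crit h"
  shows "std_normal_density (crit h) * sqrt (crit h) * sqrt \<delta> \<le> measure (rho1 h) {crit_val h - \<delta><..<crit_val h}"
proof -
  define a where "a = crit h"
  \<comment> \<open>Chosen so that \<open>h * t\<^sup>2 * (3 * a) = \<delta>\<close>, using
    \<open>3 * h * a\<^sup>2 = 1\<close>; the factor \<open>x + 2 * a\<close> is below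
    \<open>3 * a\<close>.\<close>
  define t where "t = sqrt (a * \<delta>)"
  have a: "a > 0"
    using crit_pos[OF h] by (simp add: a_def)
  have t: "t > 0" "t\<^sup>2 = a * \<delta>"
    using a assms by (auto simp: t_def)
  have "t\<^sup>2 < a\<^sup>2"
    using t(2) assms a by (simp add: a_def power2_eq_square)
  then have ta: "t < a"
    using a by (simp add: power2_less_imp_less)
  have sub: "{a - t<..<a} \<subseteq> T h -` {crit_val h - \<delta><..<crit_val h}"
  proof
    fix x assume x: "x \<in> {a - t<..<a}"
    then have x0: "0 < x" "x < a" "0 < a - x" "a - x < t"
      using ta by auto
    have eq: "crit_val h - T h x = h * (a - x)\<^sup>2 * (x + 2 * a)"
      using crit_val_minus_T[OF h, of x] by (simp add: a_def power2_commute)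
    have "0 < crit_val h - T h x"
      unfolding eq using h x0 a by (intro mult_pos_pos) auto
    moreover have "crit_val h - T h x < \<delta>"
    proof -
      have "(a - x)\<^sup>2 < t\<^sup>2"
        using x0 by (intro power_strict_mono) auto
      then have "h * (a - x)\<^sup>2 * (x + 2 * a) < h * t\<^sup>2 * (3 * a)"
        using h x0 a by (intro mult_strict_mono mult_strict_left_mono) auto
      also have "\<dots> = (3 * h * a\<^sup>2) * \<delta>"
        unfolding t(2) by (simp add: power2_eq_square)
      also have "\<dots> = \<delta>"
        using crit_sq[OF h] by (simp add: a_def)
      finally show ?thesis
        by (simp add: eq)
    qed
    ultimately show "x \<in> T h -` {crit_val h - \<delta><..<crit_val h}"
      by auto
  qed
  interpret R: prob_space rho0
    by (rule prob_space_rho0)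
  have meas: "measure rho0 {a - t<..<a} = (\<integral>x. std_normal_density x * indicator {a - t<..<a} x \<partial>lborel)"
  proof -
    have "measure rho0 {a - t<..<a} = (\<integral>x. indicator {a - t<..<a} x \<partial>rho0)"
      by (simp add: rho0_def)
    then show ?thesis
      unfolding rho0_eq by (subst (asm) integral_real_density) auto
  qed
  have "std_normal_density a * t = (\<integral>x. std_normal_density a * indicator {a - t<..<a} x \<partial>lborel)"
    using t by simp
  also have "\<dots> \<le> (\<integral>x. std_normal_density x * indicator {a - t<..<a} x \<partial>lborel)"
  proof (rule integral_mono)
    show "integrable lborel (\<lambda>x. std_normal_density x * indicator {a - t<..<a} x)"
      by (intro integrable_real_mult_indicator) auto
    have "std_normal_density a \<le> std_normal_density x" if "a - t < x" "x < a" for x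
    proof -
      have "x\<^sup>2 \<le> a\<^sup>2"
        using that ta by (intro power_mono) auto
      then show ?thesis
        by (simp add: normal_density_def divide_right_mono)
    qed
    then show "std_normal_density a * indicator {a - t<..<a} x \<le> std_normal_density x * indicator {a - t<..<a} x" for x
      by (auto simp: indicator_def)
  qed (use t in auto)
  also have "\<dots> = measure rho0 {a - t<..<a}"
    by (simp add: meas)
  also have "\<dots> \<le> measure rho0 (T h -` {crit_val h - \<delta><..<crit_val h})"
    using sub measurable_sets_borel[OF borel_measurable_T, of "{crit_val h - \<delta><..<crit_val h}" h]
    by (intro R.finite_measure_mono) (auto simp: rho0_def)
  also have "\<dots> = measure (rho1 h) {crit_val h - \<delta><..<crit_val h}"
    unfolding rho1_def by (subst measure_distr) (auto simp: rho0_def)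
  finally show ?thesis
    by (simp add: t_def a_def real_sqrt_mult mult.assoc)
qed

lemma rho1_mass_right:
  assumes "0 < \<delta>"
  shows "measure (rho1 h) {crit_val h<..<crit_val h + \<delta>} \<le> \<delta>"
proof -
  have "emeasure (rho1 h) {crit_val h<..<crit_val h + \<delta>}
      = (\<integral>\<^sup>+y. ennreal (rho1_density h y) * indicator {crit_val h<..<crit_val h + \<delta>} y \<partial>lborel)"
    unfolding rho1_eq[OF h] using borel_measurable_rho1_density[OF h] by (subst emeasure_density) auto
  also have "\<dots> \<le> (\<integral>\<^sup>+y. indicator {crit_val h<..<crit_val h + \<delta>} y \<partial>lborel)"
    using rho1_density_le_1[OF h] crit_val_pos[OF h]
    by (intro nn_integral_mono) (auto simp: indicator_def)
  also have "\<dots> = ennreal \<delta>"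
    using assms by simp
  finally show ?thesis
    using assms by (simp add: measure_def enn2real_leI)
qed

text \<open>A continuous version would be bounded on a compact interval ending at
  \<open>crit_val h\<close>. Masses are compared instead of point values, since a density is
  determined only almost everywhere.\<close>

lemma rho1_no_continuous_density:
  assumes f: "continuous_on UNIV f" "rho1 h = density lborel (\<lambda>x. ennreal (f x))"
  shows False
proof -
  have "compact (f ` {crit_val h - 1..crit_val h})"
    by (intro compact_continuous_image continuous_on_subset[OF f(1)]) auto
  then have "bounded (f ` {crit_val h - 1..crit_val h})"
    by (rule compact_imp_bounded)
  then obtain M where "\<forall>x\<in>{crit_val h - 1..crit_val h}. \<bar>f x\<bar> \<le> M"
    by (auto simp: bounded_iff)
  then have M: "\<bar>f x\<bar> \<le> M" if "x \<in> {crit_val h - 1..crit_val h}" for x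
    using that by blast
  have "M \<ge> 0"
    using M[of "crit_val h"] by auto
  define \<kappa> where "\<kappa> = std_normal_density (crit h) * sqrt (crit h)"
  have "\<kappa> > 0"
    using crit_pos[OF h] by (simp add: \<kappa>_def normal_density_pos)
  then obtain \<delta> where \<delta>: "0 < \<delta>" "\<delta> < min 1 (crit h)" "M * \<delta> < \<kappa> * sqrt \<delta>"
    using sqrt_not_le_linear[of \<kappa> "min 1 (crit h)" M] crit_pos[OF h] by auto
  have [measurable]: "f \<in> borel_measurable borel"
    using f(1) by (rule borel_measurable_continuous_onI)
  have "emeasure (rho1 h) {crit_val h - \<delta><..<crit_val h}
      = (\<integral>\<^sup>+y. ennreal (f y) * indicator {crit_val h - \<delta><..<crit_val h} y \<partial>lborel)"
    unfolding f(2) by (subst emeasure_density) auto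
  also have "\<dots> \<le> (\<integral>\<^sup>+y. ennreal M * indicator {crit_val h - \<delta><..<crit_val h} y \<partial>lborel)"
  proof (intro nn_integral_mono)
    fix y
    show "ennreal (f y) * indicator {crit_val h - \<delta><..<crit_val h} y \<le> ennreal M * indicator {crit_val h - \<delta><..<crit_val h} y"
      using M[of y] \<delta> by (auto simp: indicator_def intro!: ennreal_leI)
  qed
  also have "\<dots> = ennreal (M * \<delta>)"
    using \<delta> \<open>M \<ge> 0\<close> by (subst nn_integral_cmult_indicator) (auto simp: ennreal_mult)
  finally have "measure (rho1 h) {crit_val h - \<delta><..<crit_val h} \<le> M * \<delta>"
    using \<delta> \<open>M \<ge> 0\<close> by (simp add: measure_def enn2real_leI)
  then show False
    using rho1_mass_left[of \<delta>] \<delta> by (simp add: \<kappa>_def)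
qed

end

section \<open>No Wasserstein gradient\<close>

lemma couplings_map:
  assumes "prob_space \<rho>" "sets \<rho> = sets borel" and [measurable]: "s \<in> borel_measurable borel"
  shows "distr \<rho> borel (\<lambda>x. (x, s x)) \<in> couplings \<rho> (distr \<rho> borel s)"
proof -
  have [measurable_cong]: "sets \<rho> = sets borel"
    by fact
  have m: "(\<lambda>x. (x, s x)) \<in> measurable \<rho> borel"
    unfolding borel_prod[symmetric] by measurable
  have f: "fst \<in> borel_measurable (borel :: (real \<times> real) measure)" "snd \<in> borel_measurable (borel :: (real \<times> real) measure)"
    unfolding borel_prod[symmetric] by measurable
  have "distr \<rho> borel (\<lambda>x. x) = \<rho>"
    using assms(2) by (simp add: distr_id2)
  with m f show ?thesis
    using assms by (auto simp: couplings_def distr_distr o_def intro: prob_space.prob_space_distr)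
qed

lemma transport_cost_map_le:
  assumes "prob_space \<rho>" "sets \<rho> = sets borel" and [measurable]: "s \<in> borel_measurable borel"
    and le: "\<And>x. \<bar>s x - x\<bar> \<le> \<delta>"
  shows "transport_cost (distr \<rho> borel (\<lambda>x. (x, s x))) \<le> ennreal (\<delta>\<^sup>2)"
proof -
  interpret prob_space \<rho> by fact
  have [measurable_cong]: "sets \<rho> = sets borel"
    by fact
  have m: "(\<lambda>x. (x, s x)) \<in> measurable \<rho> borel"
    unfolding borel_prod[symmetric] by measurable
  have c: "(\<lambda>(x, y). ennreal ((y - x)\<^sup>2)) \<in> borel_measurable (borel :: (real \<times> real) measure)"
    unfolding borel_prod[symmetric] by measurable
  have "transport_cost (distr \<rho> borel (\<lambda>x. (x, s x))) = (\<integral>\<^sup>+x. ennreal ((s x - x)\<^sup>2) \<partial>\<rho>)"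
    unfolding transport_cost_def using m c by (subst nn_integral_distr) auto
  also have "\<dots> \<le> (\<integral>\<^sup>+x. ennreal (\<delta>\<^sup>2) \<partial>\<rho>)"
  proof (intro nn_integral_mono ennreal_leI)
    fix x
    have "\<bar>s x - x\<bar>\<^sup>2 \<le> \<delta>\<^sup>2"
      using le by (intro power_mono) auto
    then show "(s x - x)\<^sup>2 \<le> \<delta>\<^sup>2"
      by simp
  qed
  also have "\<dots> = ennreal (\<delta>\<^sup>2)"
    by (simp add: emeasure_space_1)
  finally show ?thesis .
qed

lemma W2_le:
  assumes "p \<in> couplings \<rho> \<nu>" "transport_cost p \<le> ennreal (\<delta>\<^sup>2)" "\<delta> \<ge> 0"
  shows "W2 \<rho> \<nu> \<le> \<delta>"
proof -
  have "(INF p\<in>couplings \<rho> \<nu>. transport_cost p) \<le> ennreal (\<delta>\<^sup>2)"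
    using assms by (meson INF_lower2)
  then have "enn2real (INF p\<in>couplings \<rho> \<nu>. transport_cost p) \<le> \<delta>\<^sup>2"
    by (intro enn2real_leI) auto
  then show ?thesis
    unfolding W2_def using assms(3) by (intro real_le_lsqrt) auto
qed

text \<open>Young's inequality weighted with \<open>\<delta>\<close> balances the norm of
  \<open>\<xi>\<close> against a cost of order \<open>\<delta>\<^sup>2\<close>. Only the cost of the
  plan enters, so any selection of optimal plans is covered.\<close>

lemma coupling_pairing_le:
  assumes p: "p \<in> couplings \<rho> \<nu>" "transport_cost p \<le> ennreal (\<delta>\<^sup>2)" and "\<delta> > 0"
    and [measurable]: "\<xi> \<in> borel_measurable borel" and int: "integrable \<rho> (\<lambda>x. (\<xi> x)\<^sup>2)"
  shows "\<bar>\<integral>(x, y). \<xi> x * (y - x) \<partial>p\<bar> \<le> \<delta> / 2 * ((\<integral>x. (\<xi> x)\<^sup>2 \<partial>\<rho>) + 1)"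
proof -
  have sets_p: "sets p = sets (borel \<Otimes>\<^sub>M borel :: (real \<times> real) measure)"
    and fst_p: "distr p borel fst = \<rho>"
    using p(1) unfolding couplings_def borel_prod by blast+
  note [measurable_cong] = sets_p
  let ?q = "\<lambda>z::real \<times> real. (snd z - fst z)\<^sup>2"
  have cost: "(\<integral>\<^sup>+z. ennreal (?q z) \<partial>p) \<le> ennreal (\<delta>\<^sup>2)"
    using p(2) by (simp add: transport_cost_def case_prod_beta')
  then have "(\<integral>\<^sup>+z. ennreal (?q z) \<partial>p) < \<infinity>"
    by (rule le_less_trans) simp
  then have q: "integrable p ?q"
    by (intro integrableI_bounded) auto
  have "ennreal (\<integral>z. ?q z \<partial>p) \<le> ennreal (\<delta>\<^sup>2)"
    using cost by (subst (asm) nn_integral_eq_integral[OF q]) auto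
  then have q_le: "(\<integral>z. ?q z \<partial>p) \<le> \<delta>\<^sup>2"
    by simp
  have \<xi>: "integrable p (\<lambda>z. (\<xi> (fst z))\<^sup>2)"
    using int unfolding fst_p[symmetric] by (subst (asm) integrable_distr_eq) auto
  have \<xi>_eq: "(\<integral>z. (\<xi> (fst z))\<^sup>2 \<partial>p) = (\<integral>x. (\<xi> x)\<^sup>2 \<partial>\<rho>)"
    unfolding fst_p[symmetric] by (subst integral_distr) auto
  have young: "\<bar>u * v\<bar> \<le> \<delta> / 2 * u\<^sup>2 + 1 / (2 * \<delta>) * v\<^sup>2" for u v :: real
  proof -
    have "0 \<le> (\<delta> * \<bar>u\<bar> - \<bar>v\<bar>)\<^sup>2"
      by simp
    then have "2 * \<delta> * \<bar>u * v\<bar> \<le> \<delta>\<^sup>2 * u\<^sup>2 + v\<^sup>2"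
      by (simp add: power2_diff power_mult_distrib abs_mult algebra_simps)
    then show ?thesis
      using \<open>\<delta> > 0\<close> by (simp add: field_simps power2_eq_square)
  qed
  have "\<bar>\<integral>z. \<xi> (fst z) * (snd z - fst z) \<partial>p\<bar> \<le> (\<integral>z. \<bar>\<xi> (fst z) * (snd z - fst z)\<bar> \<partial>p)"
    using integral_norm_bound[of p "\<lambda>z. \<xi> (fst z) * (snd z - fst z)"] by simp
  also have "\<dots> \<le> (\<integral>z. \<delta> / 2 * (\<xi> (fst z))\<^sup>2 + 1 / (2 * \<delta>) * ?q z \<partial>p)"
    using \<xi> q young \<open>\<delta> > 0\<close> by (intro integral_mono') auto
  also have "\<dots> = \<delta> / 2 * (\<integral>x. (\<xi> x)\<^sup>2 \<partial>\<rho>) + 1 / (2 * \<delta>) * (\<integral>z. ?q z \<partial>p)"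
    using \<xi> q by (simp add: \<xi>_eq)
  also have "\<dots> \<le> \<delta> / 2 * (\<integral>x. (\<xi> x)\<^sup>2 \<partial>\<rho>) + 1 / (2 * \<delta>) * \<delta>\<^sup>2"
    using q_le \<open>\<delta> > 0\<close> by (intro add_left_mono mult_left_mono) auto
  also have "\<dots> = \<delta> / 2 * ((\<integral>x. (\<xi> x)\<^sup>2 \<partial>\<rho>) + 1)"
    using \<open>\<delta> > 0\<close> by (simp add: field_simps power2_eq_square)
  finally show ?thesis
    by (simp add: case_prod_beta')
qed

text \<open>The interval of length \<open>\<delta>\<close> to the left of \<open>c\<close> is expanded by the factor \<open>3/2\<close>, the one to the right
  contracted by \<open>1/2\<close>, and the rest of the line is fixed. No point moves by more than \<open>\<delta>/2\<close>.\<close>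

definition stretch :: "real \<Rightarrow> real \<Rightarrow> real \<Rightarrow> real" where
  "stretch c \<delta> x = x + max 0 (\<delta> - \<bar>x - c\<bar>) / 2"

text \<open>The default 1 at the three kinks keeps the function positive everywhere; the kinks
  themselves form a null set.\<close>

definition stretch_deriv :: "real \<Rightarrow> real \<Rightarrow> real \<Rightarrow> real" where
  "stretch_deriv c \<delta> x = (if c - \<delta> < x \<and> x < c then 3 / 2 else if c < x \<and> x < c + \<delta> then 1 / 2 else 1)"

lemma borel_measurable_stretch [measurable]: "stretch c \<delta> \<in> borel_measurable borel"
  unfolding stretch_def[abs_def] by measurable

lemma borel_measurable_stretch_deriv [measurable]: "stretch_deriv c \<delta> \<in> borel_measurable borel"
  unfolding stretch_deriv_def[abs_def] by measurable

lemma stretch_deriv_pos: "stretch_deriv c \<delta> x > 0"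
  by (simp add: stretch_deriv_def)

lemma abs_stretch_diff_le: "\<delta> > 0 \<Longrightarrow> \<bar>stretch c \<delta> x - x\<bar> \<le> \<delta>"
  unfolding stretch_def by (smt (verit) field_sum_of_halves)

lemma stretch_outside: "\<bar>x - c\<bar> \<ge> \<delta> \<Longrightarrow> stretch c \<delta> x = x"
  by (simp add: stretch_def max_def)

lemma inj_stretch: "inj (stretch c \<delta>)"
proof (rule linorder_injI)
  fix x y :: real assume "x < y"
  then have "stretch c \<delta> x < stretch c \<delta> y"
    unfolding stretch_def by (smt (verit) field_sum_of_halves)
  then show "stretch c \<delta> x \<noteq> stretch c \<delta> y"
    by simp
qed

lemma deriv_stretch:
  assumes "\<delta> > 0" "x \<notin> {c - \<delta>, c, c + \<delta>}"
  shows "(stretch c \<delta> has_real_derivative stretch_deriv c \<delta> x) (at x)"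
proof -
  have aff: "((\<lambda>y. m * y + b) has_real_derivative m) (at x)" for m b :: real
    by (auto intro!: derivative_eq_intros)
  consider "x \<in> {..<c - \<delta>}" | "x \<in> {c - \<delta><..<c}" | "x \<in> {c<..<c + \<delta>}" | "x \<in> {c + \<delta><..}"
    using assms by fastforce
  then show ?thesis
  proof cases
    case 1
    then have "stretch_deriv c \<delta> x = 1"
      using assms(1) by (simp add: stretch_deriv_def)
    moreover have "(stretch c \<delta> has_real_derivative 1) (at x)"
      by (rule has_field_derivative_transform_within_open[OF aff[of "1" "0"] open_lessThan 1])
         (use assms(1) in \<open>simp add: stretch_def max_def field_simps\<close>)
    ultimately show ?thesis
      by (simp only:)
  next
    case 2
    then have "stretch_deriv c \<delta> x = 3 / 2"
      using assms(1) by (simp add: stretch_deriv_def)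
    moreover have "(stretch c \<delta> has_real_derivative 3 / 2) (at x)"
      by (rule has_field_derivative_transform_within_open[OF aff[of "3 / 2" "(\<delta> - c) / 2"] open_greaterThanLessThan 2])
         (use assms(1) in \<open>simp add: stretch_def max_def field_simps\<close>)
    ultimately show ?thesis
      by (simp only:)
  next
    case 3
    then have "stretch_deriv c \<delta> x = 1 / 2"
      using assms(1) by (simp add: stretch_deriv_def)
    moreover have "(stretch c \<delta> has_real_derivative 1 / 2) (at x)"
      by (rule has_field_derivative_transform_within_open[OF aff[of "1 / 2" "(\<delta> + c) / 2"] open_greaterThanLessThan 3])
         (use assms(1) in \<open>simp add: stretch_def max_def field_simps\<close>)
    ultimately show ?thesis
      by (simp only:)
  next
    case 4
    then have "stretch_deriv c \<delta> x = 1"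
      using assms(1) by (simp add: stretch_deriv_def)
    moreover have "(stretch c \<delta> has_real_derivative 1) (at x)"
      by (rule has_field_derivative_transform_within_open[OF aff[of "1" "0"] open_greaterThan 4])
         (use assms(1) in \<open>simp add: stretch_def max_def field_simps\<close>)
    ultimately show ?thesis
      by (simp only:)
  qed
qed

text \<open>The constant is the derivative of \<open>U\<close> at \<open>R\<close>, its largest
  modulus on the interval; the estimate comes from factoring \<open>y - x\<close> out of the
  difference.\<close>

lemma abs_U_diff_le:
  assumes "\<bar>x\<bar> \<le> R" "\<bar>y\<bar> \<le> R"
  shows "\<bar>U y - U x\<bar> \<le> \<bar>y - x\<bar> * (R + R ^ 3)"
proof -
  have R: "R \<ge> 0"
    using assms by linarith
  have "x\<^sup>2 \<le> R\<^sup>2" "y\<^sup>2 \<le> R\<^sup>2"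
    using assms power_mono[of "\<bar>x\<bar>" R 2] power_mono[of "\<bar>y\<bar>" R 2] by auto
  then have "\<bar>y + x\<bar> * (1 / 2 + (y\<^sup>2 + x\<^sup>2) / 4) \<le> (2 * R) * (1 / 2 + (R\<^sup>2 + R\<^sup>2) / 4)"
    using assms R by (intro mult_mono) auto
  also have "\<dots> = R + R ^ 3"
    by (simp add: power2_eq_square power3_eq_cube field_simps)
  finally have le: "\<bar>y + x\<bar> * (1 / 2 + (y\<^sup>2 + x\<^sup>2) / 4) \<le> R + R ^ 3" .
  have "U y - U x = (y - x) * ((y + x) * (1 / 2 + (y\<^sup>2 + x\<^sup>2) / 4))"
    by (simp add: U_def field_simps power2_eq_square power4_eq_xxxx)
  then have "\<bar>U y - U x\<bar> = \<bar>y - x\<bar> * (\<bar>y + x\<bar> * (1 / 2 + (y\<^sup>2 + x\<^sup>2) / 4))"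
    by (simp add: abs_mult)
  also have "\<dots> \<le> \<bar>y - x\<bar> * (R + R ^ 3)"
    using le by (intro mult_left_mono) auto
  finally show ?thesis .
qed

text \<open>The pointwise change of log-density plus potential when a particle moves along the map:
  the density at the image point is divided by the derivative.\<close>

definition KL_change :: "real \<Rightarrow> real \<Rightarrow> real \<Rightarrow> real" where
  "KL_change c \<delta> x = U (stretch c \<delta> x) - U x - ln (stretch_deriv c \<delta> x)"

lemma borel_measurable_KL_change [measurable]: "KL_change c \<delta> \<in> borel_measurable borel"
  unfolding KL_change_def[abs_def] by measurable

section \<open>Effect of the stretching map on the divergence\<close>

context
  fixes h \<delta> :: real
  assumes h: "h > 0" and \<delta>: "\<delta> > 0" "\<delta> < crit h" "\<delta> < 1"
begin

lemma abs_U_stretch_le: "\<bar>U (stretch (crit_val h) \<delta> x) - U x\<bar> \<le> \<delta> * ((crit_val h + 2) + (crit_val h + 2) ^ 3)"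
proof (cases "\<bar>x - crit_val h\<bar> \<ge> \<delta>")
  case True
  then show ?thesis
    using \<delta>(1) crit_val_pos[OF h] by (simp add: stretch_outside)
next
  case False
  \<comment> \<open>Only points within \<open>\<delta> < 1\<close> of \<open>crit_val h\<close>
    move, and by less than 1.\<close>
  then have "\<bar>x\<bar> \<le> crit_val h + 2" "\<bar>stretch (crit_val h) \<delta> x\<bar> \<le> crit_val h + 2"
    using abs_stretch_diff_le[OF \<delta>(1), of "crit_val h" x] \<delta> crit_val_pos[OF h] by linarith+
  then have "\<bar>U (stretch (crit_val h) \<delta> x) - U x\<bar> \<le> \<bar>stretch (crit_val h) \<delta> x - x\<bar> * ((crit_val h + 2) + (crit_val h + 2) ^ 3)"
    by (rule abs_U_diff_le)
  also have "\<dots> \<le> \<delta> * ((crit_val h + 2) + (crit_val h + 2) ^ 3)"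
    using abs_stretch_diff_le[OF \<delta>(1)] crit_val_pos[OF h] by (intro mult_right_mono) auto
  finally show ?thesis .
qed

lemma integrable_KL_change: "integrable (rho1 h) (KL_change (crit_val h) \<delta>)"
proof -
  interpret prob_space "rho1 h"
    by (rule prob_space_rho1[OF h])
  have [measurable_cong]: "sets (rho1 h) = sets borel"
    by (rule sets_rho1[OF h])
  have "\<bar>KL_change (crit_val h) \<delta> x\<bar> \<le> \<delta> * ((crit_val h + 2) + (crit_val h + 2) ^ 3) + (\<bar>ln (3 / 2)\<bar> + \<bar>ln (1 / 2)\<bar>)" for x
  proof -
    have "\<bar>ln (stretch_deriv (crit_val h) \<delta> x)\<bar> \<le> \<bar>ln (3 / 2)\<bar> + \<bar>ln (1 / 2)\<bar>"
      by (simp add: stretch_deriv_def)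
    then show ?thesis
      using abs_U_stretch_le[of x] unfolding KL_change_def by linarith
  qed
  then show ?thesis
    by (intro integrable_const_bound) auto
qed

text \<open>The map is injective, so off the kinks it is a single branch. Pulling the entropy of the
  image back to \<open>rho1 h\<close> adds exactly \<open>KL_change\<close> to the
  integrand.\<close>

lemma F_KL_stretch:
  "distr (rho1 h) borel (stretch (crit_val h) \<delta>) \<in> eff_domain F_KL"
  "F_KL (distr (rho1 h) borel (stretch (crit_val h) \<delta>)) = ereal ((\<integral>x. ln (rho1_density h x) + U x \<partial>rho1 h) + (\<integral>x. KL_change (crit_val h) \<delta> x \<partial>rho1 h))"
proof -
  let ?s = "stretch (crit_val h) \<delta>" and ?s' = "stretch_deriv (crit_val h) \<delta>"
  let ?\<nu> = "distr (rho1 h) borel ?s"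
  define J where "J = - {crit_val h - \<delta>, crit_val h, crit_val h + \<delta>}"
  define k where "k = branch_density (rho1_density h) ?s ?s' J"
  interpret prob_space "rho1 h"
    by (rule prob_space_rho1[OF h])
  have [measurable_cong]: "sets (rho1 h) = sets borel"
    by (rule sets_rho1[OF h])
  note [measurable] = borel_measurable_rho1_density[OF h]
  have deriv: "(?s has_real_derivative ?s' x) (at x)" if "x \<in> J" for x
    using that \<delta>(1) deriv_stretch by (auto simp: J_def)
  have inj: "inj_on ?s J"
    using inj_stretch by (rule inj_on_subset) simp
  have "open J"
    unfolding J_def by (intro open_Compl finite_imp_closed) simp
  have [measurable]: "k \<in> borel_measurable borel"
    unfolding k_def
    by (rule borel_measurable_branch_density[OF \<open>open J\<close> inj deriv]) (use stretch_deriv_pos[of "crit_val h" \<delta>] in \<open>auto simp: less_le\<close>)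
  have k_nonneg: "k y \<ge> 0" for y
    unfolding k_def by (intro branch_density_nonneg rho1_density_nonneg[OF h])
  have k_image: "k (?s x) = rho1_density h x / ?s' x" if "x \<in> J" for x
    using branch_density_image[OF inj that] stretch_deriv_pos[of "crit_val h" \<delta> x] by (simp add: k_def)
  have J_null: "AE x in lborel. x \<in> J"
    using AE_not_in[OF finite_imp_null_set_lborel[of "{crit_val h - \<delta>, crit_val h, crit_val h + \<delta>}"]] by (simp add: J_def)
  have "integrable (rho1 h) (\<lambda>x. 1 :: real)"
    by simp
  then have int: "integrable lborel (rho1_density h)"
    unfolding rho1_eq[OF h] using rho1_density_nonneg[OF h] by (subst (asm) integrable_real_density) auto
  have "?\<nu> = density lborel (\<lambda>y. ennreal (\<Sum>i\<in>{()}. k y))"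
    unfolding rho1_eq[OF h]
  proof (rule distr_density_branches[where J = "\<lambda>_. J" and t' = ?s'])
    show "k (?s x) * \<bar>?s' x\<bar> = rho1_density h x" if "x \<in> J" for x
      using k_image[OF that] stretch_deriv_pos[of "crit_val h" \<delta> x] by simp
    show "J \<in> sets borel"
      using \<open>open J\<close> by simp
    show "k y = 0" if "y \<notin> ?s ` J" for y
      using that by (simp add: k_def branch_density_outside)
  qed (use J_null int deriv inj k_nonneg rho1_density_nonneg[OF h] in \<open>auto simp: disjoint_family_on_def\<close>)
  then have \<nu>_eq: "?\<nu> = density lborel (\<lambda>y. ennreal (k y))"
    by simp
  have "AE x in rho1 h. x \<in> J"
    unfolding rho1_eq[OF h] using J_null by (subst AE_density) (auto elim: eventually_mono)
  then have AE: "AE x in rho1 h. ln (rho1_density h x) + U x + KL_change (crit_val h) \<delta> x = ln (k (?s x)) + U (?s x)"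
  proof eventually_elim
    case (elim x)
    then show ?case
      using stretch_deriv_pos[of "crit_val h" \<delta> x] rho1_density_pos[OF h, of x] by (simp add: k_image ln_div KL_change_def)
  qed
  have sum: "integrable (rho1 h) (\<lambda>x. ln (rho1_density h x) + U x + KL_change (crit_val h) \<delta> x)"
    by (intro Bochner_Integration.integrable_add[OF integrable_rho1_entropy[OF h] integrable_KL_change])
  have "integrable (rho1 h) (\<lambda>x. ln (k (?s x)) + U (?s x))"
    by (rule integrable_cong_AE_imp[OF sum _ AE]) measurable
  then have ent: "integrable ?\<nu> (\<lambda>y. ln (k y) + U y)"
    by (subst integrable_distr_eq) auto
  have "F_KL ?\<nu> = ereal (\<integral>y. ln (k y) + U y \<partial>?\<nu>)"
    unfolding \<nu>_eq by (rule rho_star_entropy(2)) (use k_nonneg ent in \<open>auto simp: \<nu>_eq\<close>)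
  also have "(\<integral>y. ln (k y) + U y \<partial>?\<nu>) = (\<integral>x. ln (k (?s x)) + U (?s x) \<partial>rho1 h)"
    by (subst integral_distr) auto
  also have "\<dots> = (\<integral>x. ln (rho1_density h x) + U x + KL_change (crit_val h) \<delta> x \<partial>rho1 h)"
    by (rule integral_cong_AE[OF _ _ AE, symmetric]) measurable
  also have "\<dots> = (\<integral>x. ln (rho1_density h x) + U x \<partial>rho1 h) + (\<integral>x. KL_change (crit_val h) \<delta> x \<partial>rho1 h)"
    by (rule Bochner_Integration.integral_add[OF integrable_rho1_entropy[OF h] integrable_KL_change])
  finally show F_eq: "F_KL ?\<nu> = ereal ((\<integral>x. ln (rho1_density h x) + U x \<partial>rho1 h) + (\<integral>x. KL_change (crit_val h) \<delta> x \<partial>rho1 h))" .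
  have "integrable (rho1 h) (\<lambda>x. (?s x)\<^sup>2)"
  proof (rule Bochner_Integration.integrable_bound)
    show "integrable (rho1 h) (\<lambda>x. 2 * x\<^sup>2 + 2 * \<delta>\<^sup>2)"
      using integrable_rho1_sq[OF h] by simp
    have "(?s x)\<^sup>2 \<le> 2 * x\<^sup>2 + 2 * \<delta>\<^sup>2" for x
    proof -
      have "\<bar>?s x - x\<bar>\<^sup>2 \<le> \<delta>\<^sup>2"
        using abs_stretch_diff_le[OF \<delta>(1)] by (intro power_mono) auto
      \<comment> \<open>The difference of the two sides is the square of
        \<open>?s x - 2 * x\<close>.\<close>
      moreover have "(?s x)\<^sup>2 \<le> 2 * x\<^sup>2 + 2 * (?s x - x)\<^sup>2"
        using zero_le_power2[of "?s x - 2 * x"] by (simp add: power2_eq_square algebra_simps)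
      ultimately show ?thesis
        by simp
    qed
    then show "AE x in rho1 h. norm ((?s x)\<^sup>2) \<le> norm (2 * x\<^sup>2 + 2 * \<delta>\<^sup>2)"
      by simp
  qed measurable
  then have "integrable ?\<nu> (\<lambda>y. y\<^sup>2)"
    by (subst integrable_distr_eq) auto
  moreover have "prob_space ?\<nu>"
    by (rule prob_space_distr) measurable
  ultimately show "?\<nu> \<in> eff_domain F_KL"
    by (simp add: eff_domain_def P2_def F_eq)
qed

text \<open>Expansion gains \<open>ln (3 / 2)\<close> per unit mass on the left block. Contraction
  loses \<open>ln 2 < 1\<close> per unit mass on the right block, whose mass is at most
  \<open>\<delta>\<close>, and the potential changes by a multiple of
  \<open>\<delta>\<close>.\<close>

lemma integral_KL_change_le:
  "(\<integral>x. KL_change (crit_val h) \<delta> x \<partial>rho1 h)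
    \<le> - ln (3 / 2) * (std_normal_density (crit h) * sqrt (crit h)) * sqrt \<delta> + \<delta> * (1 + ((crit_val h + 2) + (crit_val h + 2) ^ 3))"
proof -
  let ?A = "{crit_val h - \<delta><..<crit_val h}" and ?B = "{crit_val h<..<crit_val h + \<delta>}"
  interpret prob_space "rho1 h"
    by (rule prob_space_rho1[OF h])
  note [simp] = sets_rho1[OF h]
  have sp: "space (rho1 h) = UNIV"
    using sets_eq_imp_space_eq[OF sets_rho1[OF h]] by simp
  have ind: "integrable (rho1 h) (indicator ?A :: real \<Rightarrow> real)" "integrable (rho1 h) (indicator ?B :: real \<Rightarrow> real)"
    by (auto intro!: integrable_real_indicator simp: emeasure_eq_measure)
  have "(\<integral>x. KL_change (crit_val h) \<delta> x \<partial>rho1 h)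
      \<le> (\<integral>x. - ln (3 / 2) * indicator ?A x + ln 2 * indicator ?B x + \<delta> * ((crit_val h + 2) + (crit_val h + 2) ^ 3) \<partial>rho1 h)"
  proof (rule integral_mono[OF integrable_KL_change])
    show "integrable (rho1 h) (\<lambda>x. - ln (3 / 2) * indicator ?A x + ln 2 * indicator ?B x + \<delta> * ((crit_val h + 2) + (crit_val h + 2) ^ 3))"
      using ind by (intro Bochner_Integration.integrable_add integrable_mult_right) auto
    fix x
    have "- ln (stretch_deriv (crit_val h) \<delta> x) = - ln (3 / 2) * indicator ?A x + ln 2 * indicator ?B x"
      by (auto simp: stretch_deriv_def ln_div)
    then show "KL_change (crit_val h) \<delta> x \<le> - ln (3 / 2) * indicator ?A x + ln 2 * indicator ?B x + \<delta> * ((crit_val h + 2) + (crit_val h + 2) ^ 3)"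
      using abs_U_stretch_le[of x] unfolding KL_change_def by linarith
  qed
  also have "\<dots> = - ln (3 / 2) * measure (rho1 h) ?A + ln 2 * measure (rho1 h) ?B + \<delta> * ((crit_val h + 2) + (crit_val h + 2) ^ 3)"
    using ind by (simp add: sp prob_space[unfolded sp])
  also have "\<dots> \<le> - ln (3 / 2) * (std_normal_density (crit h) * sqrt (crit h) * sqrt \<delta>) + 1 * \<delta> + \<delta> * ((crit_val h + 2) + (crit_val h + 2) ^ 3)"
  proof -
    have "ln (3 / 2) * (std_normal_density (crit h) * sqrt (crit h) * sqrt \<delta>) \<le> ln (3 / 2) * measure (rho1 h) ?A"
      by (intro mult_left_mono rho1_mass_left[OF h \<delta>(1,2)]) simp
    moreover have "ln 2 * measure (rho1 h) ?B \<le> 1 * \<delta>"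
      using ln_2_less_1 by (intro mult_mono rho1_mass_right[OF h \<delta>(1)]) auto
    ultimately show ?thesis
      unfolding mult_minus_left by linarith
  qed
  finally show ?thesis
    by (simp add: algebra_simps)
qed

end

lemma rho1_not_S_W:
  assumes h: "h > 0"
  shows "rho1 h \<notin> S_W F_KL"
proof
  assume "rho1 h \<in> S_W F_KL"
  then obtain \<xi> where "\<xi> \<in> W_gradient F_KL (rho1 h)"
    by (auto simp: S_W_def)
  then obtain p where \<xi>: "\<xi> \<in> borel_measurable borel" "integrable (rho1 h) (\<lambda>x. (\<xi> x)\<^sup>2)"
    and opt: "\<And>\<nu>. \<nu> \<in> eff_domain F_KL \<Longrightarrow> p \<nu> \<in> optimal_plans (rho1 h) \<nu>"
    and grad: "\<And>e. e > 0 \<Longrightarrow> \<exists>d>0. \<forall>\<nu>\<in>eff_domain F_KL. W2 (rho1 h) \<nu> < d \<longrightarrow>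
      \<bar>real_of_ereal (F_KL \<nu>) - real_of_ereal (F_KL (rho1 h)) - (\<integral>(x, y). \<xi> x * (y - x) \<partial>p \<nu>)\<bar> \<le> e * W2 (rho1 h) \<nu>"
    by (auto simp: W_gradient_def)
  \<comment> \<open>Tolerance 1 is enough, because the contradiction lies in the order of
    magnitude.\<close>
  obtain d where d: "d > 0" "\<And>\<nu>. \<nu> \<in> eff_domain F_KL \<Longrightarrow> W2 (rho1 h) \<nu> < d \<Longrightarrow>
      \<bar>real_of_ereal (F_KL \<nu>) - real_of_ereal (F_KL (rho1 h)) - (\<integral>(x, y). \<xi> x * (y - x) \<partial>p \<nu>)\<bar> \<le> W2 (rho1 h) \<nu>"
    using grad[of 1] by auto
  define K where "K = (\<integral>x. (\<xi> x)\<^sup>2 \<partial>rho1 h)"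
  define L where "L = (crit_val h + 2) + (crit_val h + 2) ^ 3"
  define \<kappa> where "\<kappa> = ln (3 / 2) * (std_normal_density (crit h) * sqrt (crit h))"
  have "\<kappa> > 0"
    using crit_pos[OF h] by (simp add: \<kappa>_def normal_density_pos)
  \<comment> \<open>The linear coefficient collects \<open>1 + L\<close> from the right block and
    the potential, 1 from the remainder at tolerance 1, and \<open>(K + 1) / 2\<close> from the
    pairing.\<close>
  obtain \<delta> where \<delta>: "0 < \<delta>" "\<delta> < min (min 1 (crit h)) d" "(1 + L + (1 + (K + 1) / 2)) * \<delta> < \<kappa> * sqrt \<delta>"
    using sqrt_not_le_linear[OF \<open>\<kappa> > 0\<close>, of "min (min 1 (crit h)) d" "1 + L + (1 + (K + 1) / 2)"] crit_pos[OF h] d(1)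
    by auto
  then have \<delta>': "\<delta> < 1" "\<delta> < crit h" "\<delta> < d"
    by auto
  let ?s = "stretch (crit_val h) \<delta>"
  let ?\<nu> = "distr (rho1 h) borel ?s"
  let ?\<pi> = "distr (rho1 h) borel (\<lambda>x. (x, ?s x))"
  note F_\<nu> = F_KL_stretch[OF h \<delta>(1) \<delta>'(2,1)]
  have \<pi>: "?\<pi> \<in> couplings (rho1 h) ?\<nu>"
    by (rule couplings_map[OF prob_space_rho1[OF h] sets_rho1[OF h]]) measurable
  have cost: "transport_cost ?\<pi> \<le> ennreal (\<delta>\<^sup>2)"
    by (rule transport_cost_map_le[OF prob_space_rho1[OF h] sets_rho1[OF h]])
       (use abs_stretch_diff_le[OF \<delta>(1)] in auto)
  have W: "W2 (rho1 h) ?\<nu> \<le> \<delta>"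
    using \<pi> cost \<delta>(1) by (intro W2_le) auto
  \<comment> \<open>Optimality makes the selected plan at most as expensive as the coupling
    \<open>?\<pi>\<close> given by the map.\<close>
  have p: "p ?\<nu> \<in> couplings (rho1 h) ?\<nu>" "transport_cost (p ?\<nu>) \<le> ennreal (\<delta>\<^sup>2)"
    using opt[OF F_\<nu>(1)] \<pi> cost by (auto simp: optimal_plans_def intro: order_trans)
  have "\<bar>\<integral>(x, y). \<xi> x * (y - x) \<partial>p ?\<nu>\<bar> \<le> \<delta> / 2 * (K + 1)"
    unfolding K_def by (rule coupling_pairing_le[OF p \<delta>(1) \<xi>])
  moreover have "real_of_ereal (F_KL ?\<nu>) - real_of_ereal (F_KL (rho1 h)) \<le> - \<kappa> * sqrt \<delta> + \<delta> * (1 + L)"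
    using integral_KL_change_le[OF h \<delta>(1) \<delta>'(2,1)] by (simp add: F_\<nu>(2) F_KL_rho1[OF h] \<kappa>_def L_def)
  moreover have "\<bar>real_of_ereal (F_KL ?\<nu>) - real_of_ereal (F_KL (rho1 h)) - (\<integral>(x, y). \<xi> x * (y - x) \<partial>p ?\<nu>)\<bar> \<le> \<delta>"
    using d(2)[OF F_\<nu>(1)] W \<delta>'(3) by linarith
  ultimately have "\<kappa> * sqrt \<delta> \<le> \<delta> * (1 + L) + \<delta> + \<delta> / 2 * (K + 1)"
    by linarith
  also have "\<dots> = (1 + L + (1 + (K + 1) / 2)) * \<delta>"
    by (simp add: field_simps)
  finally show False
    using \<delta>(3) by simp
qed

theorem proposition3p1:
  fixes h :: real
  assumes "h > 0"
  shows "is_first_variation F_KL rho0 (\<lambda>x. ereal (1 + U x - V0 x)) \<and>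
    (\<forall>x. has_gradient (\<lambda>x. ereal (1 + U x - V0 x)) (deriv U x - deriv V0 x) x) \<and>
    absolutely_continuous lborel (rho1 h) \<and>
    rho1 h \<in> S_f F_KL \<and>
    \<not> (\<exists>f :: real \<Rightarrow> real. continuous_on UNIV f \<and> rho1 h = density lborel (\<lambda>x. ennreal (f x))) \<and>
    rho1 h \<notin> S_W F_KL"
  using first_variation_rho0 gradient_U_minus_V0 rho1_absolutely_continuous[OF assms] rho1_S_f[OF assms]
    rho1_no_continuous_density[OF assms] rho1_not_S_W[OF assms] by blast

end
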